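(* Let $q$ be a prime power not divisible by $2$ or $3$, let $n\ge1$, let $H=\mathrm{SL}_{2n}(\mathbb F_q)$ with Siegel parabolic subgroup $P$. One can give $\big(\operatorname{Ind}_P^H1\big)^P$ an ordered basis, indexed by $\{0,\ldots,n\}$, so that the operator $M$ on it has matrix whose $(i,j)$ entry, for $i,j\in\{0,\ldots,n\}$, is $$(-1)^{i+j-n}q^{n^2-i^2+\binom{i+j-n}2}\frac{(q;q)_i^2}{(q;q)_{n-j}^2(q;q)_{i+j-n}}$$ if $i+j\ge n$ and is $0$ if $i+j<n$. This matrix is diagonalizable and has eigenvalues given by $$\left\{(-1)^{n-i}q^{\binom n2+\binom{i+1}2}:0\le i\le n\right\}.$$
   Context: $P\subseteq H$ is the subgroup of matrices $\begin{bmatrix}A&B\\0&D\end{bmatrix}$ with $A,B,D\in\mathbb F_q^{n\times n}$, $\det(AD)=1$. $\operatorname{Ind}_P^H1$ is the space of functions $f\colon H\to\mathbb C$ with $f(pg)=f(g)$ for $p\in P$, with $H$ acting by right translation; $\big(\operatorname{Ind}_P^H1\big)^P$ is its subspace of $P$-invariant vectors. The $H$-equivariant operator $M\colon\operatorname{Ind}_P^H1\to\operatorname{Ind}_P^H1$ is $$Mf(g)=\sum_{B\in\mathbb F_q^{n\times n}}f\left(\begin{bmatrix}0&1_n\\-1_n&0\end{bmatrix}\begin{bmatrix}1_n&B\\0&1_n\end{bmatrix}g\right).$$ The $q$-Pochhammer symbol is $(a;q)_k=\prod_{i=0}^{k-1}(1-aq^i)$. *)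

theory Defs
  imports
    "HOL-Library.Function_Algebras"
    "Jordan_Normal_Form.Spectral_Radius"
begin

interpretation cfun: vector_space "\<lambda>(c::complex) (f :: 'b \<Rightarrow> complex) x. c * f x"
  by unfold_locales (auto simp: fun_eq_iff algebra_simps)

definition ordered_basis :: "nat \<Rightarrow> (nat \<Rightarrow> 'b \<Rightarrow> complex) \<Rightarrow> ('b \<Rightarrow> complex) set \<Rightarrow> bool" where
  "ordered_basis N b V \<longleftrightarrow>
     inj_on b {..<N} \<and> cfun.independent (b ` {..<N}) \<and> cfun.span (b ` {..<N}) = V"

text \<open>Columns of \<open>A\<close> are the coordinates of the images of the basis vectors.\<close>

definition has_matrix ::
    "(('b \<Rightarrow> complex) \<Rightarrow> 'b \<Rightarrow> complex) \<Rightarrow> nat \<Rightarrow> (nat \<Rightarrow> 'b \<Rightarrow> complex) \<Rightarrow> complex mat \<Rightarrow> bool" where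
  "has_matrix T N b A \<longleftrightarrow> A \<in> carrier_mat N N \<and>
     (\<forall>j<N. T (b j) = (\<lambda>x. \<Sum>i<N. A $$ (i, j) * b i x))"

definition diagonalizable :: "complex mat \<Rightarrow> bool" where
  "diagonalizable A \<longleftrightarrow> (\<exists>D. similar_mat A D \<and> diagonal_mat D)"

definition SL :: "nat \<Rightarrow> 'a::field mat set" where
  "SL m = {g \<in> carrier_mat m m. det g = 1}"

definition siegel_parabolic :: "nat \<Rightarrow> 'a::field mat set" where
  "siegel_parabolic n = {four_block_mat A B (0\<^sub>m n n) D | A B D.
     A \<in> carrier_mat n n \<and> B \<in> carrier_mat n n \<and> D \<in> carrier_mat n n \<and> det (A * D) = 1}"

text \<open>
  Functions on \<open>SL (2 * n)\<close> are represented by functions on all matrices that vanish outside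
  \<open>SL (2 * n)\<close>, so that pointwise addition and scaling give the intended vector space.
\<close>

definition Ind :: "nat \<Rightarrow> ('a::field mat \<Rightarrow> complex) set" where
  "Ind n = {f. (\<forall>g. g \<notin> SL (2 * n) \<longrightarrow> f g = 0) \<and>
     (\<forall>p \<in> siegel_parabolic n. \<forall>g \<in> SL (2 * n). f (p * g) = f g)}"

definition right_translation :: "nat \<Rightarrow> 'a::field mat \<Rightarrow> ('a mat \<Rightarrow> complex) \<Rightarrow> 'a mat \<Rightarrow> complex" where
  "right_translation n h f = (\<lambda>g. if g \<in> SL (2 * n) then f (g * h) else 0)"

definition Ind_inv :: "nat \<Rightarrow> ('a::field mat \<Rightarrow> complex) set" where
  "Ind_inv n = {f \<in> Ind n. \<forall>p \<in> siegel_parabolic n. right_translation n p f = f}"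

definition intertwiner :: "nat \<Rightarrow> ('a::field mat \<Rightarrow> complex) \<Rightarrow> 'a mat \<Rightarrow> complex" where
  "intertwiner n f = (\<lambda>g. if g \<in> SL (2 * n) then
     \<Sum>B \<in> carrier_mat n n.
       f (four_block_mat (0\<^sub>m n n) (1\<^sub>m n) (- 1\<^sub>m n) (0\<^sub>m n n) *
          four_block_mat (1\<^sub>m n) B (0\<^sub>m n n) (1\<^sub>m n) * g)
     else 0)"

definition q_pochhammer :: "complex \<Rightarrow> complex \<Rightarrow> nat \<Rightarrow> complex" where
  "q_pochhammer a q k = (\<Prod>i<k. 1 - a * q ^ i)"

text \<open>The natural-number subtractions below never truncate, since \<open>i, j \<le> n \<le> i + j\<close>.\<close>

definition M_matrix :: "nat \<Rightarrow> complex \<Rightarrow> complex mat" where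
  "M_matrix n q = mat (n + 1) (n + 1) (\<lambda>(i, j).
     if n \<le> i + j then
       (-1) ^ (i + j - n) * q ^ (n\<^sup>2 - i\<^sup>2 + ((i + j - n) choose 2)) *
       ((q_pochhammer q q i)\<^sup>2 / ((q_pochhammer q q (n - j))\<^sup>2 * q_pochhammer q q (i + j - n)))
     else 0)"

end

theory Submission
  imports Defs
begin

text \<open>
  Let \<open>c\<close> be the lower left \<open>n \<times> n\<close> block of \<open>g \<in> SL (2 * n)\<close>. Multiplying \<open>g\<close> by elements of the
  Siegel parabolic \<open>P\<close> on both sides turns \<open>c\<close> into \<open>D * c * A\<close> with invertible \<open>A\<close>, \<open>D\<close>, so the rank
  of \<open>c\<close> is constant on \<open>P g P\<close>. Conversely the rank determines the double coset: row and column
  operations from \<open>P\<close> bring the two lower blocks of \<open>g\<close> into a shape that depends on the rank only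
  (\<open>bruhat_normal_form\<close>), and elements with equal lower blocks lie in one coset of \<open>P\<close>
  (\<open>same_lower_rows_same_coset\<close>). Hence the \<open>P\<close>-invariant vectors are the functions of the rank, and
  the indicators of the \<open>n + 1\<close> possible ranks are the basis (\<open>ordered_basis_cell_indicator\<close>).

  The argument of \<open>f\<close> in the definition of the operator has lower left block \<open>- (a + B * c)\<close>, where
  \<open>a\<close> is the upper left block of \<open>g\<close>. So the indicator of rank \<open>j\<close> is sent to the function
  \<open>g \<mapsto> #{B. rank (a + B * c) = j}\<close>. If \<open>c\<close> has rank \<open>i\<close>, coordinates can be chosen such that \<open>c\<close>
  only sees the first \<open>i\<close> coordinates. The first \<open>i\<close> columns of \<open>a + B * c\<close> are then arbitrary, while
  the others are fixed and independent, because \<open>a\<close> and \<open>c\<close> have no common kernel. Adding the free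
  columns one by one gives a recursion for the count that is the \<open>q\<close>-Pascal rule
  (\<open>card_extensions\<close>), and the result is the \<open>(i, j)\<close> entry of the matrix
  (\<open>intertwiner_cell_indicator\<close>).

  For the eigenvalues, a function of the rank \<open>i\<close> is read as a function of \<open>x = q ^ (n - i)\<close>, the
  number of vectors killed by \<open>c\<close>. The matrix sends \<open>(x - 1) (x - q) \<cdots> (x - q ^ (k - 1))\<close> to a scalar
  multiple of \<open>(x - q ^ n) \<cdots> (x - q ^ (n - k + 1))\<close> (\<open>M_matrix_times_q_falling\<close>). Both polynomials
  are monic of degree \<open>k\<close>, so the matrix is triangular with respect to the first family, and the
  scalars are its eigenvalues. They have distinct absolute values, so it is diagonalizable.

  The rank is used in the form of the cardinality \<open>q ^ r\<close> of the column space throughout.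
\<close>

section \<open>Gaussian binomial coefficients and Newton polynomials\<close>

text \<open>
  The recursion is the \<open>q\<close>-Pascal rule. The sum formula and the counting of matrices below are
  inductions along it; the quotient of Pochhammer symbols that occurs in the matrix is recovered in
  \<open>gauss_binomial_pochhammer\<close>.
\<close>

fun gauss_binomial :: "complex \<Rightarrow> nat \<Rightarrow> nat \<Rightarrow> complex" where
  "gauss_binomial q m 0 = 1"
| "gauss_binomial q 0 (Suc s) = 0"
| "gauss_binomial q (Suc m) (Suc s) = gauss_binomial q m s + q ^ Suc s * gauss_binomial q m (Suc s)"

text \<open>
  For \<open>x = q ^ n\<close> this is the number of linearly independent \<open>k\<close>-tuples of vectors in a space of
  dimension \<open>n\<close> over a field with \<open>q\<close> elements.
\<close>

definition q_falling :: "complex \<Rightarrow> nat \<Rightarrow> complex \<Rightarrow> complex" where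
  "q_falling q k x = (\<Prod>t<k. x - q ^ t)"

lemma q_falling_0 [simp]: "q_falling q 0 x = 1"
  and q_falling_Suc: "q_falling q (Suc k) x = q_falling q k x * (x - q ^ k)"
  by (simp_all add: q_falling_def)

lemma q_pochhammer_0 [simp]: "q_pochhammer q q 0 = 1"
  and q_pochhammer_Suc: "q_pochhammer q q (Suc k) = q_pochhammer q q k * (1 - q ^ Suc k)"
  by (simp_all add: q_pochhammer_def)

lemma gauss_binomial_eq_0: "m < s \<Longrightarrow> gauss_binomial q m s = 0"
  by (induction q m s rule: gauss_binomial.induct) auto

text \<open>
  Multiplied out, the quotient formula for Gaussian binomials follows from the \<open>q\<close>-Pascal rule for
  every \<open>q\<close>, roots of unity included.
\<close>

lemma gauss_binomial_pochhammer:
  "gauss_binomial q (s + t) s * q_pochhammer q q s * q_pochhammer q q t = q_pochhammer q q (s + t)"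
proof (induction "s + t" arbitrary: s t)
  case (Suc m)
  show ?case
  proof (cases "s = 0 \<or> t = 0")
    case True
    have "gauss_binomial q k k = 1" for k
      by (induction k) (auto simp: gauss_binomial_eq_0)
    with True show ?thesis by auto
  next
    case False
    then obtain s' t' where st: "s = Suc s'" "t = Suc t'" by (metis not0_implies_Suc)
    have m: "m = s' + t" "m = s + t'" using Suc(2) st by auto
    have 1: "gauss_binomial q m s' * q_pochhammer q q s' * q_pochhammer q q t = q_pochhammer q q m"
      using Suc(1)[OF m(1)] m by simp
    have 2: "gauss_binomial q m s * q_pochhammer q q s * q_pochhammer q q t' = q_pochhammer q q m"
      using Suc(1)[OF m(2)] m by simp
    have G: "gauss_binomial q (s + t) s = gauss_binomial q m s' + q ^ s * gauss_binomial q m s"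
      unfolding Suc(2)[symmetric] unfolding st by simp
    have P: "q_pochhammer q q s = q_pochhammer q q s' * (1 - q ^ s)"
      "q_pochhammer q q t = q_pochhammer q q t' * (1 - q ^ t)"
      unfolding st by (simp_all only: q_pochhammer_Suc)
    have "gauss_binomial q (s + t) s * q_pochhammer q q s * q_pochhammer q q t =
       (gauss_binomial q m s' * q_pochhammer q q s' * q_pochhammer q q t) * (1 - q ^ s) +
       (gauss_binomial q m s * q_pochhammer q q s * q_pochhammer q q t') * (q ^ s * (1 - q ^ t))"
      unfolding G P by (simp add: algebra_simps)
    also have "\<dots> = q_pochhammer q q m * (1 - q ^ (s + t))"
      unfolding 1 2 by (simp add: algebra_simps power_add)
    also have "\<dots> = q_pochhammer q q (s + t)"
      unfolding Suc(2)[symmetric] by (simp add: q_pochhammer_Suc)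
    finally show ?thesis .
  qed
qed simp

text \<open>
  Each factor is \<open>q ^ (k + l) - q ^ t = - (q ^ t) * (1 - q ^ (k + l - t))\<close>; the signs and the powers of
  \<open>q\<close> are collected in front of the Pochhammer symbols.
\<close>

lemma q_falling_power:
  "q_falling q k (q ^ (k + l)) * q_pochhammer q q l = (-1) ^ k * q ^ (k choose 2) * q_pochhammer q q (k + l)"
proof (induction k arbitrary: l)
  case (Suc k)
  have "q_falling q (Suc k) (q ^ (Suc k + l)) * q_pochhammer q q l =
     - (q ^ k) * (q_falling q k (q ^ (k + Suc l)) * q_pochhammer q q (Suc l))"
    by (simp add: q_falling_Suc q_pochhammer_Suc algebra_simps power_add)
  also have "\<dots> = - (q ^ k) * ((-1) ^ k * q ^ (k choose 2) * q_pochhammer q q (k + Suc l))"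
    unfolding Suc ..
  also have "\<dots> = (-1) ^ Suc k * q ^ (Suc k choose 2) * q_pochhammer q q (Suc k + l)"
    by (simp add: numeral_2_eq_2 power_add)
  finally show ?case .
qed (simp add: numeral_2_eq_2)

lemma q_falling_eq_0: "m < k \<Longrightarrow> q_falling q k (q ^ m) = 0"
  by (auto simp: q_falling_def)

text \<open>
  For \<open>x = q ^ l\<close> both sides count the \<open>l \<times> m\<close> matrices over a field with \<open>q\<close> elements, the left
  hand side by rank. Writing \<open>x = (x - q ^ s) + q ^ s\<close> in the term with index \<open>s\<close> turns the induction
  step into the \<open>q\<close>-Pascal rule.
\<close>

lemma sum_gauss_binomial_q_falling:
  "(\<Sum>s\<le>m. gauss_binomial q m s * q_falling q s x) = x ^ m"
proof (induction m)
  case (Suc m)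
  let ?G = "gauss_binomial q m" and ?P = "\<lambda>s. q_falling q s x"
  have "x ^ Suc m = (\<Sum>s\<le>m. ?G s * ?P s) * x"
    unfolding Suc by simp
  also have "\<dots> = (\<Sum>s\<le>m. ?G s * ?P s * (x - q ^ s)) + (\<Sum>s\<le>m. q ^ s * ?G s * ?P s)"
    by (simp only: sum_distrib_right sum.distrib[symmetric]) (simp add: algebra_simps)
  also have "(\<Sum>s\<le>m. q ^ s * ?G s * ?P s) = (\<Sum>s\<le>Suc m. q ^ s * ?G s * ?P s)"
    by (simp add: gauss_binomial_eq_0)
  also have "\<dots> = 1 + (\<Sum>s\<le>m. q ^ Suc s * ?G (Suc s) * ?P (Suc s))"
    by (subst sum.atMost_Suc_shift) simp
  also have "(\<Sum>s\<le>m. ?G s * ?P s * (x - q ^ s)) = (\<Sum>s\<le>m. ?G s * ?P (Suc s))"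
    by (simp only: q_falling_Suc mult.assoc)
  also have "(\<Sum>s\<le>m. ?G s * ?P (Suc s)) + (1 + (\<Sum>s\<le>m. q ^ Suc s * ?G (Suc s) * ?P (Suc s)))
      = 1 + (\<Sum>s\<le>m. gauss_binomial q (Suc m) (Suc s) * ?P (Suc s))"
    by (simp add: sum.distrib distrib_right)
  also have "\<dots> = (\<Sum>s\<le>Suc m. gauss_binomial q (Suc m) s * ?P s)"
    by (subst sum.atMost_Suc_shift) simp
  finally show ?case ..
qed simp

text \<open>
  Both products are monic of degree \<open>k\<close>, so one Newton basis is expressed in the other by a
  unitriangular matrix. Only the coefficient on the diagonal matters for eigenvalues.
\<close>

lemma newton_basis_change:
  fixes a b :: "nat \<Rightarrow> 'a::comm_ring_1"
  shows "\<exists>c. c k = 1 \<and> (\<forall>x. (\<Prod>t<k. x - a t) = (\<Sum>l\<le>k. c l * (\<Prod>t<l. x - b t)))"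
proof (induction k)
  case 0
  show ?case by (rule exI[of _ "\<lambda>_. 1"]) simp
next
  case (Suc k)
  then obtain c where c: "c k = 1"
    and cx: "\<And>x. (\<Prod>t<k. x - a t) = (\<Sum>l\<le>k. c l * (\<Prod>t<l. x - b t))" by blast
  let ?B = "\<lambda>x l. \<Prod>t<l. x - b t"
  \<comment> \<open>The new factor is \<open>x - a k = (x - b l) + (b l - a k)\<close> in the term with index \<open>l\<close>.\<close>
  define d where "d = (\<lambda>l. (if l = 0 then 0 else c (l - 1)) + (if l \<le> k then c l * (b l - a k) else 0))"
  have "(\<Prod>t<Suc k. x - a t) = (\<Sum>l\<le>Suc k. d l * ?B x l)" for x
  proof -
    have "(\<Prod>t<Suc k. x - a t) = (\<Sum>l\<le>k. c l * ?B x l) * (x - a k)"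
      by (simp add: cx)
    also have "\<dots> = (\<Sum>l\<le>k. c l * ?B x (Suc l)) + (\<Sum>l\<le>k. c l * (b l - a k) * ?B x l)"
      by (simp add: sum_distrib_right sum_distrib_left sum.distrib[symmetric] algebra_simps)
    also have "(\<Sum>l\<le>k. c l * ?B x (Suc l)) = (\<Sum>l\<le>Suc k. (if l = 0 then 0 else c (l - 1)) * ?B x l)"
      by (subst sum.atMost_Suc_shift) simp
    also have "(\<Sum>l\<le>k. c l * (b l - a k) * ?B x l) =
        (\<Sum>l\<le>Suc k. (if l \<le> k then c l * (b l - a k) else 0) * ?B x l)"
      by simp
    finally show ?thesis
      unfolding d_def by (simp only: sum.distrib[symmetric] distrib_right)
  qed
  moreover have "d (Suc k) = 1" by (simp add: d_def c)
  ultimately show ?case by blast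
qed

section \<open>The spectrum of the matrix\<close>

text \<open>
  A Jordan block of size \<open>k\<close> makes its eigenvalue a root of multiplicity at least \<open>k\<close> of the
  characteristic polynomial, so all blocks have size one here.
\<close>

lemma diagonalizable_if_distinct_roots:
  assumes A: "A \<in> carrier_mat N N"
    and cp: "char_poly A = (\<Prod>i\<leftarrow>[0..<N]. [:- e i, 1:])"
    and inj: "inj_on e {..<N}"
  shows "diagonalizable A"
proof -
  have "char_poly A = (\<Prod>a\<leftarrow>map e [0..<N]. [:- a, 1:])"
    unfolding cp by (simp add: o_def)
  from jordan_nf_exists[OF A this] obtain ks where ks: "jordan_nf A ks" by blast
  have ord: "order a (char_poly A) \<le> 1" for a
  proof -
    have "order a (char_poly A) = (\<Sum>i\<leftarrow>[0..<N]. order a [:- e i, 1:])"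
      unfolding cp by (subst order_prod_list) (auto simp: o_def)
    also have "\<dots> = (\<Sum>i<N. order a [:- e i, 1:])"
      by (simp add: interv_sum_list_conv_sum_set_nat atLeast0LessThan)
    also have "\<dots> = (\<Sum>i<N. if a = e i then 1 else 0)"
      by (intro sum.cong) (auto simp: order_linear' order_0I)
    also have "\<dots> = card {i \<in> {..<N}. a = e i}" by (simp add: sum.If_cases Int_def)
    also have "\<dots> \<le> 1"
      using inj by (subst card_le_Suc0_iff_eq[unfolded One_nat_def[symmetric]]) (auto dest: inj_onD)
    finally show ?thesis .
  qed
  have one: "k = 1" if "(k, a) \<in> set ks" for k a
  proof -
    have "k \<noteq> 0" using ks that unfolding jordan_nf_def by force
    moreover have "k \<le> 1" using jordan_nf_block_size_order_bound[OF ks that] ord[of a] by simp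
    ultimately show ?thesis by simp
  qed
  have "diagonal_mat (jordan_matrix ks)" using one
  proof (induction ks)
    case Nil
    show ?case by (simp add: jordan_matrix_def diagonal_mat_def)
  next
    case (Cons ka ks)
    obtain a where ka: "ka = (1, a)" using Cons(2) by (metis list.set_intros(1) surj_pair)
    have IH: "diagonal_mat (jordan_matrix ks)" using Cons by auto
    have "square_mat (jordan_matrix ks)" by simp
    with IH show ?case
      unfolding ka jordan_matrix_def diagonal_mat_def
      by (auto simp: Let_def jordan_block_def)
  qed
  with ks show ?thesis unfolding diagonalizable_def jordan_nf_def by blast
qed

lemma q_pochhammer_nonzero: "(\<And>k. k > 0 \<Longrightarrow> q ^ k \<noteq> 1) \<Longrightarrow> q_pochhammer q q k \<noteq> 0"
proof (induction k)
  case (Suc k)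
  have "q ^ Suc k \<noteq> 1" by (rule Suc.prems) simp
  with Suc.IH[OF Suc.prems] show ?case by (simp add: q_pochhammer_Suc)
qed simp

text \<open>
  Up to a common factor this is the \<open>q\<close>-analogue of \<open>(i choose s) * (i - s choose k) =
  (i choose k) * (i - k choose s)\<close>. Both sides vanish if \<open>i < k + s\<close>.
\<close>

lemma gauss_binomial_q_falling:
  assumes roots: "\<And>k. k > 0 \<Longrightarrow> q ^ k \<noteq> 1" and "s \<le> i"
  shows "gauss_binomial q i s * q_falling q k (q ^ (i - s)) = q_falling q k (q ^ i) * gauss_binomial q (i - k) s"
proof -
  note nz = q_pochhammer_nonzero[of q, OF roots]
  consider "k + s \<le> i" | "i < k" | "k \<le> i" "i < k + s" by linarith
  then show ?thesis
  proof cases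
    case 1
    then obtain r where r: "i = k + s + r" using le_Suc_ex by blast
    let ?p = "q_pochhammer q q" and ?c = "(-1) ^ k * q ^ (k choose 2)"
    have "gauss_binomial q i s * ?p s * ?p (k + r) = ?p i"
      using gauss_binomial_pochhammer[of q s "k + r"] by (simp add: r add_ac)
    then have 1: "gauss_binomial q i s = ?p i / (?p s * ?p (k + r))"
      using nz by (simp add: field_simps)
    have "q_falling q k (q ^ (i - s)) * ?p r = ?c * ?p (k + r)"
      using q_falling_power[of q k r] by (simp add: r)
    then have 2: "q_falling q k (q ^ (i - s)) = ?c * ?p (k + r) / ?p r"
      using nz by (simp add: field_simps)
    have "q_falling q k (q ^ i) * ?p (s + r) = ?c * ?p i"
      using q_falling_power[of q k "s + r"] by (simp add: r add_ac)
    then have 3: "q_falling q k (q ^ i) = ?c * ?p i / ?p (s + r)"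
      using nz by (simp add: field_simps)
    have "gauss_binomial q (i - k) s * ?p s * ?p r = ?p (s + r)"
      using gauss_binomial_pochhammer[of q s r] by (simp add: r)
    then have 4: "gauss_binomial q (i - k) s = ?p (s + r) / (?p s * ?p r)"
      using nz by (simp add: field_simps)
    show ?thesis unfolding 1 2 3 4 using nz by simp
  next
    case 2
    then show ?thesis by (simp add: q_falling_eq_0)
  next
    case 3
    then have "i - s < k" "i - k < s" using \<open>s \<le> i\<close> by linarith+
    then show ?thesis by (simp add: q_falling_eq_0 gauss_binomial_eq_0)
  qed
qed

text \<open>
  This is the form in which the entries arise from counting: the product of a Gaussian binomial and
  \<open>q_falling\<close> is the number of \<open>i \<times> i\<close> matrices of rank \<open>i + j - n\<close> over a field with \<open>q\<close> elements.
\<close>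

lemma M_matrix_entry:
  assumes roots: "\<And>k. k > 0 \<Longrightarrow> q ^ k \<noteq> 1" and "i \<le> n" "j \<le> n"
  shows "M_matrix n q $$ (i, j) = (if n \<le> i + j then q ^ (n\<^sup>2 - i\<^sup>2) *
    (gauss_binomial q i (i + j - n) * q_falling q (i + j - n) (q ^ i)) else 0)"
proof (cases "n \<le> i + j")
  case True
  note nz = q_pochhammer_nonzero[of q, OF roots]
  define s t where "s = i + j - n" and "t = n - j"
  let ?p = "q_pochhammer q q"
  have i: "i = s + t" using True assms(2,3) by (simp add: s_def t_def)
  have 1: "gauss_binomial q i s = ?p i / (?p s * ?p t)"
    using gauss_binomial_pochhammer[of q s t] nz by (simp add: i field_simps)
  have 2: "q_falling q s (q ^ i) = (-1) ^ s * q ^ (s choose 2) * ?p i / ?p t"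
    using q_falling_power[of q s t] nz by (simp add: i field_simps)
  have "M_matrix n q $$ (i, j) =
      (-1) ^ s * q ^ (n\<^sup>2 - i\<^sup>2 + (s choose 2)) * ((?p i)\<^sup>2 / ((?p t)\<^sup>2 * ?p s))"
    using True assms(2,3) by (simp add: M_matrix_def s_def t_def)
  also have "\<dots> = q ^ (n\<^sup>2 - i\<^sup>2) * (gauss_binomial q i s * q_falling q s (q ^ i))"
    unfolding 1 2 by (simp add: power_add power2_eq_square mult_ac)
  finally show ?thesis using True by (simp add: s_def)
next
  case False
  then show ?thesis using assms(2,3) by (simp add: M_matrix_def)
qed

text \<open>
  For \<open>n = k + m\<close>, this matches the exponent \<open>n * m + (k choose 2)\<close> produced by the computation with
  the exponent \<open>(n choose 2) + (m + 1 choose 2)\<close> of the \<open>m\<close>-th eigenvalue.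
\<close>

lemma choose_two_add: "(k + m) * m + (k choose 2) = ((k + m) choose 2) + ((m + 1) choose 2)"
proof (induction k)
  case 0
  show ?case by (induction m) (auto simp: numeral_2_eq_2)
qed (simp add: numeral_2_eq_2)

text \<open>
  The factor \<open>q ^ (n - i) - q ^ (n - t)\<close> equals \<open>- (q ^ (n - i)) * (q ^ i - q ^ t) / q ^ t\<close>. The power
  of \<open>q\<close> on the left clears the denominators \<open>q ^ t\<close>.
\<close>

lemma prod_power_diff:
  fixes q :: complex
  assumes "i \<le> n" "k \<le> n"
  shows "q ^ (k choose 2) * (\<Prod>t<k. q ^ (n - i) - q ^ (n - t)) = (-1) ^ k * q ^ ((n - i) * k) * q_falling q k (q ^ i)"
  using assms(2)
proof (induction k)
  case (Suc k)
  have step: "q ^ k * (q ^ (n - i) - q ^ (n - k)) = - (q ^ (n - i)) * (q ^ i - q ^ k)"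
    using assms Suc by (simp add: algebra_simps flip: power_add)
  have "q ^ (Suc k choose 2) = q ^ (k choose 2) * q ^ k"
    by (simp add: numeral_2_eq_2 power_add)
  then have "q ^ (Suc k choose 2) * (\<Prod>t<Suc k. q ^ (n - i) - q ^ (n - t)) =
      (q ^ (k choose 2) * (\<Prod>t<k. q ^ (n - i) - q ^ (n - t))) * (- (q ^ (n - i)) * (q ^ i - q ^ k))"
    unfolding step[symmetric] by (simp add: mult_ac)
  also have "\<dots> = ((-1) ^ k * q ^ ((n - i) * k) * q_falling q k (q ^ i)) * (- (q ^ (n - i)) * (q ^ i - q ^ k))"
    using Suc by simp
  also have "\<dots> = (-1) ^ Suc k * q ^ ((n - i) * Suc k) * q_falling q (Suc k) (q ^ i)"
    by (simp add: q_falling_Suc power_add)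
  finally show ?case .
qed (simp add: numeral_2_eq_2)

definition M_eigenvalue :: "nat \<Rightarrow> complex \<Rightarrow> nat \<Rightarrow> complex" where
  "M_eigenvalue n q i = (-1) ^ (n - i) * q ^ ((n choose 2) + ((i + 1) choose 2))"

text \<open>
  This is the reason for the shape of the spectrum. As functions of \<open>x = q ^ (n - j)\<close>, the vectors
  multiplied by the matrix are the polynomials \<open>q_falling q k x\<close>, and the results are multiples of
  polynomials of the same degree with the same leading coefficient. After
  \<open>gauss_binomial_q_falling\<close> has moved the factor depending on \<open>k\<close> out of the sum, the remaining sum
  is a power of \<open>q ^ i\<close> by \<open>sum_gauss_binomial_q_falling\<close>.
\<close>

lemma M_matrix_times_q_falling:
  assumes roots: "\<And>k. k > 0 \<Longrightarrow> q ^ k \<noteq> 1" and i: "i \<le> n" and k: "k \<le> n"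
  shows "(\<Sum>j<n + 1. M_matrix n q $$ (i, j) * q_falling q k (q ^ (n - j))) =
    M_eigenvalue n q (n - k) * (\<Prod>t<k. q ^ (n - i) - q ^ (n - t))"
proof -
  let ?G = "\<lambda>s. gauss_binomial q i s * q_falling q s (q ^ i)"
  have "(\<Sum>j<n + 1. M_matrix n q $$ (i, j) * q_falling q k (q ^ (n - j))) =
      (\<Sum>j\<in>{n - i..n}. q ^ (n\<^sup>2 - i\<^sup>2) * ?G (i + j - n) * q_falling q k (q ^ (n - j)))"
    using i by (intro sum.mono_neutral_cong_right) (auto simp: M_matrix_entry[OF roots])
  also have "\<dots> = (\<Sum>s\<le>i. q ^ (n\<^sup>2 - i\<^sup>2) * ?G s * q_falling q k (q ^ (i - s)))"
    using i by (intro sum.reindex_bij_witness[of _ "\<lambda>s. s + (n - i)" "\<lambda>j. i + j - n"]) auto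
  also have "\<dots> = (\<Sum>s\<le>i. q ^ (n\<^sup>2 - i\<^sup>2) * q_falling q k (q ^ i) * (gauss_binomial q (i - k) s * q_falling q s (q ^ i)))"
  proof (intro sum.cong refl)
    fix s assume "s \<in> {..i}"
    then have "gauss_binomial q i s * q_falling q k (q ^ (i - s)) = q_falling q k (q ^ i) * gauss_binomial q (i - k) s"
      by (intro gauss_binomial_q_falling[OF roots]) auto
    then show "q ^ (n\<^sup>2 - i\<^sup>2) * ?G s * q_falling q k (q ^ (i - s)) =
       q ^ (n\<^sup>2 - i\<^sup>2) * q_falling q k (q ^ i) * (gauss_binomial q (i - k) s * q_falling q s (q ^ i))"
      by (simp add: mult_ac)
  qed
  also have "\<dots> = q ^ (n\<^sup>2 - i\<^sup>2) * q_falling q k (q ^ i) * (\<Sum>s\<le>i. gauss_binomial q (i - k) s * q_falling q s (q ^ i))"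
    by (simp add: sum_distrib_left)
  also have "(\<Sum>s\<le>i. gauss_binomial q (i - k) s * q_falling q s (q ^ i)) =
      (\<Sum>s\<le>i - k. gauss_binomial q (i - k) s * q_falling q s (q ^ i))"
    by (intro sum.mono_neutral_right) (auto simp: gauss_binomial_eq_0)
  also have "\<dots> = (q ^ i) ^ (i - k)"
    by (rule sum_gauss_binomial_q_falling)
  also have "q ^ (n\<^sup>2 - i\<^sup>2) * q_falling q k (q ^ i) * (q ^ i) ^ (i - k) =
      q ^ (n * (n - k) + (n - i) * k) * q_falling q k (q ^ i)"
  proof (cases "k \<le> i")
    case True
    then obtain a where a: "i = k + a" using le_Suc_ex by blast
    obtain b where b: "n = i + b" using i le_Suc_ex by blast
    have "n\<^sup>2 - i\<^sup>2 = b * (2 * i + b)" unfolding b by (simp add: power2_eq_square algebra_simps)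
    then have "n\<^sup>2 - i\<^sup>2 + i * (i - k) = n * (n - k) + (n - i) * k"
      unfolding a b by (simp add: algebra_simps)
    then have "q ^ (n * (n - k) + (n - i) * k) = q ^ (n\<^sup>2 - i\<^sup>2) * (q ^ i) ^ (i - k)"
      by (metis power_add power_mult)
    then show ?thesis by (simp add: mult_ac)
  next
    case False
    then show ?thesis by (simp add: q_falling_eq_0)
  qed
  also have "\<dots> = (-1) ^ k * q ^ (n * (n - k)) * (q ^ (k choose 2) * (\<Prod>t<k. q ^ (n - i) - q ^ (n - t)))"
  proof -
    have "(-1 :: complex) ^ k * (-1) ^ k = 1" by (simp flip: power_mult_distrib)
    then show ?thesis unfolding prod_power_diff[OF i k] power_add by simp
  qed
  also have "\<dots> = M_eigenvalue n q (n - k) * (\<Prod>t<k. q ^ (n - i) - q ^ (n - t))"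
  proof -
    have "q ^ ((n choose 2) + ((n - k + 1) choose 2)) = q ^ (n * (n - k)) * q ^ (k choose 2)"
      using choose_two_add[of k "n - k"] k by (simp flip: power_add)
    then show ?thesis using k by (simp add: M_eigenvalue_def)
  qed
  finally show ?thesis .
qed

lemma char_poly_lower_triangular:
  assumes A: "(A :: complex mat) \<in> carrier_mat N N" and lt: "\<And>i j. i < j \<Longrightarrow> j < N \<Longrightarrow> A $$ (i, j) = 0"
  shows "char_poly A = (\<Prod>i\<leftarrow>[0..<N]. [:- A $$ (i, i), 1:])"
proof -
  have "char_poly A = char_poly (transpose_mat A)" using A by simp
  also have "\<dots> = (\<Prod>a\<leftarrow>diag_mat (transpose_mat A). [:- a, 1:])"
    using A lt by (intro char_poly_upper_triangular[of _ N]) auto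
  also have "map (\<lambda>a. [:- a, 1:]) (diag_mat (transpose_mat A)) = map (\<lambda>i. [:- A $$ (i, i), 1:]) [0..<N]"
    using A by (auto simp: diag_mat_def)
  finally show ?thesis .
qed

text \<open>
  The columns of \<open>V\<close> are the values of the Newton polynomials, in order of decreasing degree. This
  order makes \<open>V\<close> triangular as well, hence visibly invertible, and puts the eigenvalues on the
  diagonal of \<open>T\<close> in the order in which \<open>M_eigenvalue\<close> enumerates them.
\<close>

lemma char_poly_M_matrix:
  assumes roots: "\<And>k. k > 0 \<Longrightarrow> q ^ k \<noteq> 1" and q: "q \<noteq> 0"
  shows "char_poly (M_matrix n q) = (\<Prod>i\<leftarrow>[0..<n + 1]. [:- M_eigenvalue n q i, 1:])"
proof -
  let ?N = "n + 1"
  define V where "V = mat ?N ?N (\<lambda>(i, j). q_falling q (n - j) (q ^ (n - i)))"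
  obtain c where c: "\<And>k. c k k = (1 :: complex)"
    and cx: "\<And>k x. (\<Prod>t<k. x - q ^ (n - t)) = (\<Sum>l\<le>k. c k l * q_falling q l x)"
    using newton_basis_change[of _ "\<lambda>t. q ^ (n - t)" "\<lambda>t. q ^ t"] unfolding q_falling_def by metis
  define T where "T = mat ?N ?N (\<lambda>(l, j). if j \<le> l then M_eigenvalue n q j * c (n - j) (n - l) else 0)"
  have M: "M_matrix n q \<in> carrier_mat ?N ?N" and V: "V \<in> carrier_mat ?N ?N" and T: "T \<in> carrier_mat ?N ?N"
    by (simp_all add: M_matrix_def V_def T_def)
  have MV: "M_matrix n q * V = V * T"
  proof (rule eq_matI)
    fix i j assume "i < dim_row (V * T)" "j < dim_col (V * T)"
    then have ij: "i \<le> n" "j \<le> n" using V T by auto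
    have "(M_matrix n q * V) $$ (i, j) = (\<Sum>l<?N. M_matrix n q $$ (i, l) * q_falling q (n - j) (q ^ (n - l)))"
      using ij M V by (auto simp: scalar_prod_def V_def atLeast0LessThan intro!: sum.cong)
    also have "\<dots> = M_eigenvalue n q (n - (n - j)) * (\<Prod>t<n - j. q ^ (n - i) - q ^ (n - t))"
      by (rule M_matrix_times_q_falling[OF roots]) (use ij in auto)
    also have "\<dots> = (\<Sum>k\<le>n - j. M_eigenvalue n q j * (c (n - j) k * q_falling q k (q ^ (n - i))))"
      using ij by (simp add: cx sum_distrib_left)
    also have "\<dots> = (\<Sum>l\<in>{j..n}. M_eigenvalue n q j * (c (n - j) (n - l) * q_falling q (n - l) (q ^ (n - i))))"
      using ij by (intro sum.reindex_bij_witness[of _ "\<lambda>l. n - l" "\<lambda>k. n - k"]) auto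
    also have "\<dots> = (\<Sum>l<?N. V $$ (i, l) * T $$ (l, j))"
      using ij by (intro sum.mono_neutral_cong_left) (auto simp: V_def T_def)
    also have "\<dots> = (V * T) $$ (i, j)"
      using ij V T by (auto simp: scalar_prod_def atLeast0LessThan intro!: sum.cong)
    finally show "(M_matrix n q * V) $$ (i, j) = (V * T) $$ (i, j)" .
  qed (use M V T in auto)
  have "q_falling q k (q ^ k) \<noteq> 0" for k
  proof -
    have "q ^ k - q ^ t \<noteq> 0" if "t < k" for t
    proof -
      have "q ^ k = q ^ t * q ^ (k - t)" using that by (simp flip: power_add)
      then show ?thesis using roots[of "k - t"] that q by auto
    qed
    then show ?thesis by (simp add: q_falling_def)
  qed
  moreover have "upper_triangular V"
    by (auto simp: V_def q_falling_eq_0)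
  ultimately have "det V \<noteq> 0"
    using V by (subst upper_triangular_imp_det_eq_0_iff[of _ ?N]) (auto simp: diag_mat_def V_def)
  from det_non_zero_imp_unit[OF V this, of "()"]
  obtain W where W: "W \<in> carrier_mat ?N ?N" "W * V = 1\<^sub>m ?N" "V * W = 1\<^sub>m ?N"
    unfolding Units_def ring_mat_def by auto
  have "M_matrix n q = M_matrix n q * (V * W)" using M W by simp
  also have "\<dots> = V * T * W" using M V W(1) MV by (metis assoc_mult_mat)
  finally have "similar_mat (M_matrix n q) T"
    unfolding similar_mat_def similar_mat_wit_def Let_def using M V T W
    by (intro exI[of _ V] exI[of _ W]) auto
  then have "char_poly (M_matrix n q) = char_poly T" by (rule char_poly_similar)
  also have "\<dots> = (\<Prod>i\<leftarrow>[0..<?N]. [:- T $$ (i, i), 1:])"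
    by (rule char_poly_lower_triangular[OF T]) (simp add: T_def)
  also have "map (\<lambda>i. [:- T $$ (i, i), 1:]) [0..<?N] = map (\<lambda>i. [:- M_eigenvalue n q i, 1:]) [0..<?N]"
    by (auto simp: T_def c)
  finally show ?thesis .
qed

lemma of_nat_power_neq_1:
  assumes "Q \<ge> 2" "k > 0"
  shows "(of_nat Q :: complex) ^ k \<noteq> 1"
proof -
  have "Q ^ k > 1" using assms by (intro one_less_power) auto
  then have "(of_nat (Q ^ k) :: complex) \<noteq> of_nat 1" unfolding of_nat_eq_iff by linarith
  then show ?thesis by simp
qed

text \<open>
  The eigenvalues are distinct because their absolute values are powers of \<open>Q\<close> with exponents that
  increase strictly in \<open>i\<close>.
\<close>

lemma M_matrix_diagonalizable_spectrum:
  assumes Q: "Q \<ge> 2"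
  shows "diagonalizable (M_matrix n (of_nat Q))"
    and "spectrum (M_matrix n (of_nat Q)) = {M_eigenvalue n (of_nat Q) i | i. i \<le> n}"
proof -
  have M: "M_matrix n (of_nat Q) \<in> carrier_mat (n + 1) (n + 1)"
    by (simp add: M_matrix_def)
  note cp = char_poly_M_matrix[of "of_nat Q" n, OF of_nat_power_neq_1[OF Q]]
  have "inj_on (M_eigenvalue n (of_nat Q)) {..<n + 1}"
  proof (rule inj_onI)
    fix i j assume "M_eigenvalue n (of_nat Q) i = M_eigenvalue n (of_nat Q) j"
    then have "norm (M_eigenvalue n (of_nat Q) i) = norm (M_eigenvalue n (of_nat Q) j)" by simp
    then have "((n choose 2) + ((i + 1) choose 2)) = ((n choose 2) + ((j + 1) choose 2))"
      using Q by (simp add: M_eigenvalue_def norm_mult norm_power power_inject_exp)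
    moreover have "strict_mono (\<lambda>i. (i + 1) choose 2)"
      unfolding strict_mono_Suc_iff by (simp add: numeral_2_eq_2)
    ultimately show "i = j" using strict_mono_eq[of "\<lambda>i. (i + 1) choose 2" i j] by simp
  qed
  with cp Q show "diagonalizable (M_matrix n (of_nat Q))"
    by (intro diagonalizable_if_distinct_roots[OF M]) auto
  have "poly (char_poly (M_matrix n (of_nat Q))) x = 0 \<longleftrightarrow> (\<exists>i\<le>n. x = M_eigenvalue n (of_nat Q) i)" for x
  proof -
    have "poly (char_poly (M_matrix n (of_nat Q))) x = (\<Prod>i\<leftarrow>[0..<n + 1]. x - M_eigenvalue n (of_nat Q) i)"
      using Q by (subst cp) (simp_all add: poly_prod_list o_def del: upt_Suc)
    then show ?thesis by (auto simp: prod_list_zero_iff less_Suc_eq_le simp del: upt_Suc)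
  qed
  then show "spectrum (M_matrix n (of_nat Q)) = {M_eigenvalue n (of_nat Q) i | i. i \<le> n}"
    unfolding spectrum_root_char_poly[OF M] by auto
qed

section \<open>Column spaces over a finite field\<close>

lemma card_UNIV_field_ge_2: "card (UNIV :: 'a::{field, finite} set) \<ge> 2"
proof -
  have "card {0, 1 :: 'a} \<le> card (UNIV :: 'a set)" by (intro card_mono) auto
  then show ?thesis by simp
qed

lemma power_card_UNIV_inject:
  "card (UNIV :: 'a::{field, finite} set) ^ r = card (UNIV :: 'a set) ^ s \<longleftrightarrow> r = s"
  using card_UNIV_field_ge_2[where 'a = 'a] by (simp add: power_inject_exp)

text \<open>
  The column space serves to express ranks: over a field with \<open>q\<close> elements, a matrix has rank \<open>r\<close> iff
  its column space has \<open>q ^ r\<close> elements.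
\<close>

definition mat_range :: "'a::semiring_1 mat \<Rightarrow> 'a vec set" where
  "mat_range A = (\<lambda>x. A *\<^sub>v x) ` carrier_vec (dim_col A)"

definition col_lists :: "nat \<Rightarrow> nat \<Rightarrow> 'a vec list set" where
  "col_lists n l = {vs. set vs \<subseteq> carrier_vec n \<and> length vs = l}"

lemma card_carrier_vec:
  "finite (carrier_vec n :: 'a::finite vec set)" "card (carrier_vec n :: 'a vec set) = card (UNIV :: 'a set) ^ n"
proof -
  have b: "bij_betw vec_of_list {xs :: 'a list. set xs \<subseteq> UNIV \<and> length xs = n} (carrier_vec n)"
  proof (rule bij_betw_byWitness[of _ list_of_vec])
    show "list_of_vec ` carrier_vec n \<subseteq> {xs :: 'a list. set xs \<subseteq> UNIV \<and> length xs = n}"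
      by (auto simp: carrier_vecD)
    show "vec_of_list ` {xs :: 'a list. set xs \<subseteq> UNIV \<and> length xs = n} \<subseteq> carrier_vec n"
      by (intro image_subsetI carrier_vecI) simp
  qed (simp_all add: list_vec vec_list)
  show "finite (carrier_vec n :: 'a vec set)"
    using bij_betw_finite[OF b] finite_lists_length_eq[of "UNIV :: 'a set" n] by simp
  show "card (carrier_vec n :: 'a vec set) = card (UNIV :: 'a set) ^ n"
    using bij_betw_same_card[OF b] card_lists_length_eq[of "UNIV :: 'a set" n] by simp
qed

lemma card_col_lists:
  "finite (col_lists n l :: 'a::finite vec list set)" "card (col_lists n l :: 'a vec list set) = card (UNIV :: 'a set) ^ (n * l)"
  unfolding col_lists_def
  by (auto simp: finite_lists_length_eq card_lists_length_eq card_carrier_vec power_mult)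

lemma mat_of_cols_bij: "bij_betw (mat_of_cols n) (col_lists n l) (carrier_mat n l)"
proof (rule bij_betw_byWitness[of _ cols])
  show "\<forall>A\<in>carrier_mat n l. mat_of_cols n (cols A) = A"
    using mat_of_cols_cols by (metis carrier_matD(1))
  show "cols ` carrier_mat n l \<subseteq> col_lists n l"
    by (auto simp: col_lists_def dest!: subsetD[OF cols_dim])
qed (auto simp: col_lists_def)

lemma finite_carrier_mat: "finite (carrier_mat n l :: 'a::finite mat set)"
  using mat_of_cols_bij bij_betw_finite card_col_lists(1) by blast

lemma mat_range_carrier: "A \<in> carrier_mat n l \<Longrightarrow> mat_range A \<subseteq> carrier_vec n"
  by (auto simp: mat_range_def)

lemma mat_range_add: "A \<in> carrier_mat n l \<Longrightarrow> v \<in> mat_range A \<Longrightarrow> w \<in> mat_range A \<Longrightarrow> v + w \<in> mat_range A"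
  unfolding mat_range_def by (auto simp: image_iff intro!: bexI[of _ "_ + _"] mult_add_distrib_mat_vec[symmetric])

lemma mat_range_smult:
  "A \<in> carrier_mat n l \<Longrightarrow> v \<in> mat_range (A :: 'a::comm_ring_1 mat) \<Longrightarrow> t \<cdot>\<^sub>v v \<in> mat_range A"
  unfolding mat_range_def by (auto simp: image_iff intro!: bexI[of _ "t \<cdot>\<^sub>v _"] mult_mat_vec[symmetric])

lemma mat_of_cols_Cons_mult_vec:
  assumes "v \<in> carrier_vec n" "set vs \<subseteq> carrier_vec n" "x \<in> carrier_vec (length vs)"
  shows "mat_of_cols n (v # vs) *\<^sub>v vCons t x = t \<cdot>\<^sub>v v + mat_of_cols n vs *\<^sub>v (x :: 'a::comm_ring_1 vec)"
proof (rule eq_vecI)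
  fix i assume "i < dim_vec (t \<cdot>\<^sub>v v + mat_of_cols n vs *\<^sub>v x)"
  then have i: "i < n" by simp
  have "row (mat_of_cols n (v # vs)) i = vCons (v $ i) (row (mat_of_cols n vs) i)"
    using i assms by (intro eq_vecI) (auto simp: vec_index_vCons mat_of_cols_index nth_Cons')
  then show "(mat_of_cols n (v # vs) *\<^sub>v vCons t x) $ i = (t \<cdot>\<^sub>v v + mat_of_cols n vs *\<^sub>v x) $ i"
    using i assms by (simp add: mult.commute)
qed simp

lemma mat_range_Cons:
  assumes "v \<in> carrier_vec n" "set vs \<subseteq> carrier_vec n"
  shows "mat_range (mat_of_cols n (v # vs)) =
    (\<lambda>(t, w). t \<cdot>\<^sub>v v + w) ` (UNIV \<times> mat_range (mat_of_cols n vs :: 'a::comm_ring_1 mat))"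
proof -
  have carrier_Suc: "(carrier_vec (Suc l) :: 'a vec set) = (\<lambda>(t, x). vCons t x) ` (UNIV \<times> carrier_vec l)" for l
  proof (intro equalityI subsetI)
    fix x :: "'a vec" assume "x \<in> carrier_vec (Suc l)"
    then have "x = vCons (x $ 0) (vec l (\<lambda>i. x $ Suc i))"
      by (intro eq_vecI) (auto simp: vec_index_vCons)
    then show "x \<in> (\<lambda>(t, x). vCons t x) ` (UNIV \<times> carrier_vec l)"
      by (intro image_eqI[of _ _ "(x $ 0, vec l (\<lambda>i. x $ Suc i))"]) simp_all
  qed auto
  let ?M = "mat_of_cols n (v # vs)" and ?N = "mat_of_cols n vs" and ?C = "UNIV \<times> carrier_vec (length vs)"
  have "mat_range ?M = (\<lambda>(t, x). ?M *\<^sub>v vCons t x) ` ?C"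
    unfolding mat_range_def by (simp add: carrier_Suc image_image case_prod_unfold)
  also have "\<dots> = (\<lambda>(t, x). t \<cdot>\<^sub>v v + ?N *\<^sub>v x) ` ?C"
    using assms by (intro image_cong refl) (clarsimp simp: mat_of_cols_Cons_mult_vec)
  also have "\<dots> = (\<lambda>(t, w). t \<cdot>\<^sub>v v + w) ` (map_prod id (\<lambda>x. ?N *\<^sub>v x) ` ?C)"
    by (simp add: image_image case_prod_unfold)
  also have "map_prod id (\<lambda>x. ?N *\<^sub>v x) ` ?C = UNIV \<times> mat_range ?N"
    unfolding mat_range_def by (rule map_prod_surj_on) simp_all
  finally show ?thesis .
qed

text \<open>
  A new column \<open>v\<close> outside the column space \<open>W\<close> makes all \<open>t \<cdot>\<^sub>v v + w\<close> with \<open>w \<in> W\<close> pairwise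
  distinct, and one inside adds nothing.
\<close>

lemma card_mat_range_Cons:
  fixes vs :: "'a::{field, finite} vec list"
  assumes v: "v \<in> carrier_vec n" and vs: "set vs \<subseteq> carrier_vec n"
  shows "card (mat_range (mat_of_cols n (v # vs))) =
    (if v \<in> mat_range (mat_of_cols n vs) then 1 else card (UNIV :: 'a set)) * card (mat_range (mat_of_cols n vs))"
proof -
  let ?A = "mat_of_cols n vs" and ?W = "mat_range (mat_of_cols n vs)"
  have A: "?A \<in> carrier_mat n (length vs)" by simp
  note W = mat_range_carrier[OF A] and add = mat_range_add[OF A] and smult = mat_range_smult[OF A]
  show ?thesis
  proof (cases "v \<in> ?W")
    case True
    have "(\<lambda>(t, w). t \<cdot>\<^sub>v v + w) ` (UNIV \<times> ?W) = ?W"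
    proof (intro equalityI subsetI)
      fix w assume w: "w \<in> ?W"
      then have "w \<in> carrier_vec n" using W by blast
      then have "w = 0 \<cdot>\<^sub>v v + w" using v by (intro eq_vecI) auto
      with w show "w \<in> (\<lambda>(t, w). t \<cdot>\<^sub>v v + w) ` (UNIV \<times> ?W)"
        by (intro image_eqI[of _ _ "(0, w)"]) simp_all
    qed (clarify, intro add smult True)
    with True show ?thesis by (simp add: mat_range_Cons[OF v vs])
  next
    case False
    have "inj_on (\<lambda>(t, w). t \<cdot>\<^sub>v v + w) (UNIV \<times> ?W)"
    proof (rule inj_onI, clarify)
      fix t w t' w' assume w: "w \<in> ?W" "w' \<in> ?W" and eq: "t \<cdot>\<^sub>v v + w = t' \<cdot>\<^sub>v v + w'"
      have wc: "w \<in> carrier_vec n" "w' \<in> carrier_vec n" using w W by auto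
      have e: "(t - t') * v $ i = w' $ i - w $ i" if "i < n" for i
      proof -
        have "(t \<cdot>\<^sub>v v + w) $ i = (t' \<cdot>\<^sub>v v + w') $ i" using eq by simp
        then show ?thesis using that v wc by (simp add: algebra_simps)
      qed
      have "t = t'"
      proof (rule ccontr)
        assume "t \<noteq> t'"
        then have "v = inverse (t - t') \<cdot>\<^sub>v (w' + (-1) \<cdot>\<^sub>v w)"
          using v wc by (intro eq_vecI) (simp_all flip: e)
        also have "\<dots> \<in> ?W" by (intro add smult w)
        finally show False using False by simp
      qed
      moreover from this have "w = w'" using e wc by (intro eq_vecI) auto
      ultimately show "t = t' \<and> w = w'" by simp
    qed
    with False show ?thesis by (simp add: mat_range_Cons[OF v vs] card_image card_cartesian_product)
  qed
qed

lemma mat_range_Cons_mono: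
  assumes "v \<in> carrier_vec n" "set vs \<subseteq> carrier_vec n"
  shows "mat_range (mat_of_cols n vs) \<subseteq> mat_range (mat_of_cols n (v # vs) :: 'a::comm_ring_1 mat)"
proof
  fix w assume w: "w \<in> mat_range (mat_of_cols n vs)"
  then have "w \<in> carrier_vec n" using mat_range_carrier[OF mat_of_cols_carrier(1)] by blast
  then have "w = 0 \<cdot>\<^sub>v v + w" using assms(1) by (intro eq_vecI) auto
  with w show "w \<in> mat_range (mat_of_cols n (v # vs))"
    unfolding mat_range_Cons[OF assms] by (intro image_eqI[of _ _ "(0, w)"]) simp_all
qed

lemma mat_range_append_mono:
  assumes "set vs \<subseteq> carrier_vec n" "set ws \<subseteq> carrier_vec n"
  shows "mat_range (mat_of_cols n ws) \<subseteq> mat_range (mat_of_cols n (vs @ ws) :: 'a::comm_ring_1 mat)"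
  using assms(1)
proof (induction vs)
  case (Cons v vs)
  then have "mat_range (mat_of_cols n (vs @ ws)) \<subseteq> mat_range (mat_of_cols n (v # (vs @ ws)))"
    using assms(2) by (intro mat_range_Cons_mono) auto
  with Cons show ?case by auto
qed simp

section \<open>Counting column extensions by rank\<close>

definition extensions :: "nat \<Rightarrow> 'a::{field, finite} vec list \<Rightarrow> nat \<Rightarrow> nat \<Rightarrow> 'a vec list set" where
  "extensions n ws l r =
    {vs \<in> col_lists n l. card (mat_range (mat_of_cols n (vs @ ws))) = card (UNIV :: 'a set) ^ r}"

text \<open>
  The first column lies either in the span of the others, which then has \<open>q ^ r\<close> elements, or
  outside of that span, which then has \<open>q ^ (r - 1)\<close> elements.
\<close>

lemma card_extensions_Suc:
  fixes ws :: "'a::{field, finite} vec list"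
  defines "q \<equiv> card (UNIV :: 'a set)"
  assumes ws: "set ws \<subseteq> carrier_vec n"
  shows "(of_nat (card (extensions n ws (Suc l) r)) :: complex) =
    of_nat q ^ r * of_nat (card (extensions n ws l r)) +
    (if r = 0 then 0 else (of_nat q ^ n - of_nat q ^ (r - 1)) * of_nat (card (extensions n ws l (r - 1))))"
proof -
  let ?W = "\<lambda>vs. mat_range (mat_of_cols n (vs @ ws))"
  let ?E = "extensions n ws l"
  \<comment> \<open>\<open>F\<close> is empty for \<open>r = 0\<close>: a column outside the span of the others forces positive rank.\<close>
  define F where "F = {vs \<in> col_lists n l. q * card (?W vs) = q ^ r}"
  let ?S1 = "SIGMA vs:?E r. ?W vs" and ?S2 = "SIGMA vs:F. carrier_vec n - ?W vs"
  have q: "q \<ge> 2" using card_UNIV_field_ge_2 by (simp add: q_def)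
  have W: "?W vs \<subseteq> carrier_vec n" for vs by (rule mat_range_carrier[OF mat_of_cols_carrier(1)])
  have finW: "finite (?W vs)" for vs using W card_carrier_vec(1) by (rule finite_subset)
  have finE: "finite (?E r)" and finF: "finite F"
    by (auto simp: extensions_def F_def card_col_lists(1))
  have F: "F = (if r = 0 then {} else ?E (r - 1))"
    using q by (cases r) (auto simp: F_def extensions_def simp flip: q_def)
  have "extensions n ws (Suc l) r = (\<lambda>(vs, v). v # vs) ` (?S1 \<union> ?S2)"
  proof (intro equalityI subsetI)
    fix us assume us: "us \<in> extensions n ws (Suc l) r"
    then obtain v vs where vs: "us = v # vs" "v \<in> carrier_vec n" "vs \<in> col_lists n l"
      by (cases us) (auto simp: extensions_def col_lists_def)
    then have "card (mat_range (mat_of_cols n (v # (vs @ ws)))) = (if v \<in> ?W vs then 1 else q) * card (?W vs)"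
      using ws unfolding q_def by (intro card_mat_range_Cons) (auto simp: col_lists_def)
    with us vs q have "(vs, v) \<in> ?S1 \<union> ?S2"
      by (auto simp: extensions_def F_def q_def split: if_splits)
    with vs show "us \<in> (\<lambda>(vs, v). v # vs) ` (?S1 \<union> ?S2)"
      by (intro image_eqI[of _ _ "(vs, v)"]) simp_all
  next
    fix us assume "us \<in> (\<lambda>(vs, v). v # vs) ` (?S1 \<union> ?S2)"
    then obtain v vs where vs: "us = v # vs" "(vs, v) \<in> ?S1 \<union> ?S2" by auto
    then have v: "v \<in> carrier_vec n" "vs \<in> col_lists n l"
      using W by (auto simp: extensions_def F_def)
    then have "card (mat_range (mat_of_cols n (v # (vs @ ws)))) = (if v \<in> ?W vs then 1 else q) * card (?W vs)"
      using ws unfolding q_def by (intro card_mat_range_Cons) (auto simp: col_lists_def)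
    with vs v q show "us \<in> extensions n ws (Suc l) r"
      by (auto simp: extensions_def F_def q_def col_lists_def)
  qed
  then have "card (extensions n ws (Suc l) r) = card (?S1 \<union> ?S2)"
    by (simp add: card_image inj_on_def split_beta prod_eq_iff)
  also have "\<dots> = card ?S1 + card ?S2"
    using finE finF finW card_carrier_vec(1)[of n]
    by (intro card_Un_disjoint finite_SigmaI) (auto simp: extensions_def F_def q_def split: if_splits)
  also have "of_nat \<dots> = (\<Sum>vs\<in>?E r. of_nat (card (?W vs))) +
      (\<Sum>vs\<in>F. of_nat (card (carrier_vec n - ?W vs)) :: complex)"
    using finE finF finW card_carrier_vec(1)[of n] by (subst (1 2) card_SigmaI) auto
  also have "(\<Sum>vs\<in>?E r. of_nat (card (?W vs))) = (\<Sum>vs\<in>?E r. of_nat q ^ r :: complex)"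
    by (intro sum.cong) (auto simp: extensions_def q_def)
  also have "(\<Sum>vs\<in>F. of_nat (card (carrier_vec n - ?W vs))) = (\<Sum>vs\<in>F. of_nat q ^ n - of_nat q ^ (r - 1) :: complex)"
  proof (intro sum.cong refl)
    fix vs assume "vs \<in> F"
    then have "card (?W vs) = q ^ (r - 1)" by (auto simp: F extensions_def q_def split: if_splits)
    moreover have "card (carrier_vec n - ?W vs) = card (carrier_vec n :: 'a vec set) - card (?W vs)"
      using finW W by (rule card_Diff_subset)
    moreover have "card (?W vs) \<le> card (carrier_vec n :: 'a vec set)"
      using card_carrier_vec(1) W by (rule card_mono)
    ultimately show "of_nat (card (carrier_vec n - ?W vs)) = (of_nat q ^ n - of_nat q ^ (r - 1) :: complex)"
      by (simp add: of_nat_diff card_carrier_vec(2) flip: q_def)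
  qed
  finally show ?thesis by (simp add: F mult.commute)
qed

text \<open>
  Further columns do not lower the rank.
\<close>

lemma extensions_below:
  fixes ws :: "'a::{field, finite} vec list"
  assumes ws: "set ws \<subseteq> carrier_vec n" and s: "card (mat_range (mat_of_cols n ws)) = card (UNIV :: 'a set) ^ s"
    and "r < s"
  shows "extensions n ws l r = {}"
proof -
  let ?q = "card (UNIV :: 'a set)"
  have "vs \<notin> extensions n ws l r" for vs
  proof
    assume vs: "vs \<in> extensions n ws l r"
    then have "set vs \<subseteq> carrier_vec n" and r: "card (mat_range (mat_of_cols n (vs @ ws))) = ?q ^ r"
      by (simp_all add: extensions_def col_lists_def)
    then have "card (mat_range (mat_of_cols n ws)) \<le> card (mat_range (mat_of_cols n (vs @ ws)))"
      using mat_range_append_mono[of vs n ws] ws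
        finite_subset[OF mat_range_carrier[OF mat_of_cols_carrier(1)] card_carrier_vec(1)]
      by (intro card_mono) auto
    then have "?q ^ s \<le> ?q ^ r" unfolding r s .
    moreover have "?q ^ r < ?q ^ s" using card_UNIV_field_ge_2[where 'a = 'a] \<open>r < s\<close> by (intro power_strict_increasing) auto
    ultimately show False by simp
  qed
  then show ?thesis by blast
qed

text \<open>
  After division by the product of the \<open>q ^ n - q ^ (s + u)\<close> and by the power of \<open>q\<close> that records the
  columns already contained in a span, the recursion \<open>card_extensions_Suc\<close> is the \<open>q\<close>-Pascal rule.
\<close>

lemma card_extensions:
  fixes ws :: "'a::{field, finite} vec list"
  defines "q \<equiv> card (UNIV :: 'a set)"
  assumes ws: "set ws \<subseteq> carrier_vec n" and s: "card (mat_range (mat_of_cols n ws)) = q ^ s"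
  shows "(of_nat (card (extensions n ws l (s + t))) :: complex) =
    gauss_binomial (of_nat q) l t * (\<Prod>u<t. of_nat q ^ n - of_nat q ^ (s + u)) * of_nat q ^ (s * (l - t))"
proof (induction l arbitrary: t)
  case 0
  have "q \<ge> 2" using card_UNIV_field_ge_2 by (simp add: q_def)
  then have inj: "q ^ a = q ^ b \<longleftrightarrow> a = b" for a b by (simp add: power_inject_exp)
  have "extensions n ws 0 (s + t) = (if t = 0 then {[]} else {})"
  proof -
    have "extensions n ws 0 (s + t) = {vs. vs = [] \<and> q ^ s = q ^ (s + t)}"
      unfolding extensions_def col_lists_def q_def[symmetric] by (auto simp: s)
    then show ?thesis by (auto simp: inj)
  qed
  then show ?case by (cases t) auto
next
  case (Suc l)
  let ?g = "gauss_binomial (of_nat q)" and ?q = "of_nat q :: complex"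
  show ?case
  proof (cases t)
    case 0
    have "(if s = 0 then 0 else (?q ^ n - ?q ^ (s - 1)) * of_nat (card (extensions n ws l (s - 1)))) = 0"
      using extensions_below[OF ws, of s "s - 1"] s by (simp add: q_def)
    then have "of_nat (card (extensions n ws (Suc l) (s + t))) = ?q ^ s * of_nat (card (extensions n ws l (s + 0)))"
      unfolding 0 by (simp only: card_extensions_Suc[OF ws, of l s, folded q_def] add_0_right)
    also have "\<dots> = ?q ^ s * ?q ^ (s * l)"
      unfolding Suc.IH by simp
    also have "\<dots> = ?g (Suc l) t * (\<Prod>u<t. ?q ^ n - ?q ^ (s + u)) * ?q ^ (s * (Suc l - t))"
      by (simp add: 0 power_add)
    finally show ?thesis .
  next
    case t: (Suc t')
    let ?P = "\<lambda>t. \<Prod>u<t. ?q ^ n - ?q ^ (s + u)"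
    have P: "?P t = ?P t' * (?q ^ n - ?q ^ (s + t'))" by (simp add: t)
    have G: "?q ^ s * ?g l t * ?q ^ (s * (l - t)) = ?g l t * ?q ^ (s * (l - t'))"
    proof (cases "t \<le> l")
      case True
      then have "l - t' = Suc (l - t)" using t by simp
      then show ?thesis by (simp add: power_add)
    qed (simp add: gauss_binomial_eq_0)
    have "of_nat (card (extensions n ws (Suc l) (s + t))) =
      ?q ^ (s + t) * (?g l t * ?P t * ?q ^ (s * (l - t))) +
      (?q ^ n - ?q ^ (s + t')) * (?g l t' * ?P t' * ?q ^ (s * (l - t')))"
    proof -
      have "(s + t = 0) = False" "s + t - 1 = s + t'" using t by simp_all
      then show ?thesis
        by (simp only: card_extensions_Suc[OF ws, of l "s + t", folded q_def] Suc.IH if_False)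
    qed
    also have "\<dots> = ?q ^ t * (?q ^ s * ?g l t * ?q ^ (s * (l - t))) * ?P t + ?g l t' * ?q ^ (s * (l - t')) * ?P t"
      unfolding P power_add[of _ s t] by (simp only: mult_ac)
    also have "\<dots> = (?g l t' + ?q ^ t * ?g l t) * ?P t * ?q ^ (s * (l - t'))"
      unfolding G by (simp add: distrib_right distrib_left mult_ac)
    also have "?g l t' + ?q ^ t * ?g l t = ?g (Suc l) t" by (simp add: t)
    also have "l - t' = Suc l - t" by (simp add: t)
    finally show ?thesis .
  qed
qed

section \<open>Rank normal form\<close>

definition unit_block :: "nat \<Rightarrow> nat \<Rightarrow> nat \<Rightarrow> 'a::semiring_1 mat" where
  "unit_block m n r = mat m n (\<lambda>(i, j). if i = j \<and> i < r then 1 else 0)"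

lemma unit_block_carrier [simp]: "unit_block m n r \<in> carrier_mat m n"
  by (simp add: unit_block_def)

lemma dim_unit_block [simp]: "dim_row (unit_block m n r) = m" "dim_col (unit_block m n r) = n"
  by (simp_all add: unit_block_def)

lemma index_mult_unit_block:
  assumes "X \<in> carrier_mat l m" "r \<le> m" "i < l" "j < n"
  shows "(X * unit_block m n r) $$ (i, j) = (if j < r then X $$ (i, j) else 0)"
proof -
  have "(X * unit_block m n r) $$ (i, j) = (\<Sum>k<m. X $$ (i, k) * (if k = j \<and> k < r then 1 else 0))"
    using assms by (auto simp: scalar_prod_def unit_block_def atLeast0LessThan intro!: sum.cong)
  also have "\<dots> = (\<Sum>k<m. if k = j then (if j < r then X $$ (i, j) else 0) else 0)"
    by (intro sum.cong) auto
  also have "\<dots> = (if j < r then X $$ (i, j) else 0)"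
    using assms by auto
  finally show ?thesis .
qed

lemma index_unit_block_mult:
  assumes "X \<in> carrier_mat n l" "r \<le> n" "i < m" "j < l"
  shows "(unit_block m n r * X) $$ (i, j) = (if i < r then X $$ (i, j) else 0)"
proof -
  have "(unit_block m n r * X) $$ (i, j) = (\<Sum>k<n. (if i = k \<and> i < r then 1 else 0) * X $$ (k, j))"
    using assms by (auto simp: scalar_prod_def unit_block_def atLeast0LessThan intro!: sum.cong)
  also have "\<dots> = (\<Sum>k<n. if i = k then (if i < r then X $$ (i, j) else 0) else 0)"
    by (intro sum.cong) auto
  also have "\<dots> = (if i < r then X $$ (i, j) else 0)"
    using assms by auto
  finally show ?thesis .
qed

lemma inverse_if_det_nonzero:
  assumes A: "(A :: 'a::field mat) \<in> carrier_mat n n" and "det A \<noteq> 0"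
  obtains W where "W \<in> carrier_mat n n" "A * W = 1\<^sub>m n" "W * A = 1\<^sub>m n" "det A * det W = 1"
proof -
  from det_non_zero_imp_unit[OF A \<open>det A \<noteq> 0\<close>, of "()"]
  obtain W where W: "W \<in> carrier_mat n n" "W * A = 1\<^sub>m n" "A * W = 1\<^sub>m n"
    unfolding Units_def ring_mat_def by auto
  moreover have "det A * det W = 1" using det_mult[OF A W(1)] W(3) by simp
  ultimately show ?thesis using that by blast
qed

lemma mat_range_mult_right:
  assumes A: "(A :: 'a::field mat) \<in> carrier_mat m n" and Q: "Q \<in> carrier_mat n n" "det Q \<noteq> 0"
  shows "mat_range (A * Q) = mat_range A"
proof -
  obtain W where W: "W \<in> carrier_mat n n" "Q * W = 1\<^sub>m n"
    using inverse_if_det_nonzero[OF Q] by blast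
  have "(\<lambda>x. Q *\<^sub>v x) ` carrier_vec n = carrier_vec n"
  proof (intro equalityI subsetI)
    fix x :: "'a vec" assume x: "x \<in> carrier_vec n"
    then have "x = Q *\<^sub>v (W *\<^sub>v x)"
      using assoc_mult_mat_vec[OF Q(1) W(1) x] W(2) by simp
    then show "x \<in> (\<lambda>x. Q *\<^sub>v x) ` carrier_vec n" using W(1) x by (intro image_eqI[of _ _ "W *\<^sub>v x"]) auto
  qed (use Q in auto)
  then have "mat_range A = (\<lambda>x. A *\<^sub>v (Q *\<^sub>v x)) ` carrier_vec n"
    using A unfolding mat_range_def by (metis carrier_matD(2) image_image)
  also have "\<dots> = mat_range (A * Q)"
    unfolding mat_range_def using A Q by (intro image_cong) auto
  finally show ?thesis ..
qed

lemma card_mat_range_mult_left: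
  assumes A: "(A :: 'a::field mat) \<in> carrier_mat m n" and P: "P \<in> carrier_mat m m" "det P \<noteq> 0"
  shows "card (mat_range (P * A)) = card (mat_range A)"
proof -
  obtain W where W: "W \<in> carrier_mat m m" "W * P = 1\<^sub>m m"
    using inverse_if_det_nonzero[OF P] by blast
  have "inj_on (\<lambda>x. P *\<^sub>v x) (carrier_vec m)"
  proof (rule inj_on_inverseI[of _ "\<lambda>x. W *\<^sub>v x"])
    fix x :: "'a vec" assume x: "x \<in> carrier_vec m"
    show "W *\<^sub>v (P *\<^sub>v x) = x"
      using assoc_mult_mat_vec[OF W(1) P(1) x] W(2) x by simp
  qed
  then have "inj_on (\<lambda>x. P *\<^sub>v x) (mat_range A)"
    using mat_range_carrier[OF A] by (rule inj_on_subset)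
  moreover have "mat_range (P * A) = (\<lambda>x. P *\<^sub>v x) ` mat_range A"
    unfolding mat_range_def image_image using A P by (intro image_cong) auto
  ultimately show ?thesis by (simp add: card_image)
qed

lemma card_mat_range_unit_block:
  assumes "r \<le> n"
  shows "card (mat_range (unit_block n n r :: 'a::{field, finite} mat)) = card (UNIV :: 'a set) ^ r"
proof -
  let ?h = "\<lambda>x :: 'a vec. vec n (\<lambda>i. if i < r then x $ i else 0)"
  have mv: "unit_block n n r *\<^sub>v x = ?h x" if "x \<in> carrier_vec n" for x :: "'a vec"
  proof (rule eq_vecI)
    fix i assume "i < dim_vec (?h x)"
    then have i: "i < n" by simp
    have "(unit_block n n r *\<^sub>v x) $ i = (\<Sum>k<n. (if i = k \<and> i < r then 1 else 0) * x $ k)"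
      using i that by (auto simp: unit_block_def scalar_prod_def atLeast0LessThan intro!: sum.cong)
    also have "\<dots> = (\<Sum>k<n. if i = k then (if i < r then x $ i else 0) else 0)"
      by (intro sum.cong) auto
    finally show "(unit_block n n r *\<^sub>v x) $ i = ?h x $ i" using i by auto
  qed (simp add: unit_block_def)
  have "mat_range (unit_block n n r) = ?h ` carrier_vec n"
    unfolding mat_range_def using mv by (intro image_cong) (auto simp: unit_block_def)
  also have "\<dots> = ?h ` carrier_vec r"
  proof (intro equalityI subsetI)
    fix y assume "y \<in> ?h ` carrier_vec n"
    then obtain x where x: "y = ?h x" by blast
    have "y = ?h (vec r (\<lambda>i. x $ i))" unfolding x using assms by (intro eq_vecI) simp_all
    then show "y \<in> ?h ` carrier_vec r" by (rule image_eqI) simp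
  next
    fix y assume "y \<in> ?h ` carrier_vec r"
    then obtain x where x: "y = ?h x" by blast
    have "?h x = ?h (?h x)" by (intro eq_vecI) simp_all
    then show "y \<in> ?h ` carrier_vec n" unfolding x by (rule image_eqI) simp
  qed
  finally have "mat_range (unit_block n n r) = ?h ` carrier_vec r" .
  moreover have "inj_on ?h (carrier_vec r)"
  proof (rule inj_onI)
    fix x y assume xy: "x \<in> carrier_vec r" "y \<in> carrier_vec r" "?h x = ?h y"
    show "x = y"
    proof (rule eq_vecI)
      fix i assume "i < dim_vec y"
      then have "i < r" using xy by simp
      then show "x $ i = y $ i" using arg_cong[OF xy(3), of "\<lambda>v. v $ i"] assms by simp
    qed (use xy in simp)
  qed
  ultimately show ?thesis by (simp add: card_image card_carrier_vec)
qed

lemma det_swaprows_mat_nonzero: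
  assumes "k < n" "l < n"
  shows "det (swaprows_mat n k l :: 'a::field mat) \<noteq> 0"
proof
  assume "det (swaprows_mat n k l :: 'a mat) = 0"
  then have "det (swaprows_mat n k l * swaprows_mat n k l :: 'a mat) = 0"
    by (simp add: det_mult[OF swaprows_mat_carrier swaprows_mat_carrier])
  then show False by (simp add: swaprows_mat_inv[OF assms])
qed

lemma mult_mat_regroup:
  assumes "S \<in> carrier_mat m m" "L \<in> carrier_mat m m" "E \<in> carrier_mat m n" "U \<in> carrier_mat n n" "T \<in> carrier_mat n n"
  shows "S * (L * E * U) * T = (S * L) * E * (U * (T :: 'a::semiring_1 mat))"
proof -
  have "S * (L * E * U) * T = S * (L * E * U * T)"
    using assms by (intro assoc_mult_mat[of _ m m _ n _ n]) auto
  also have "L * E * U * T = L * E * (U * T)"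
    using assms by (intro assoc_mult_mat[of _ m n _ n _ n]) auto
  also have "S * (L * E * (U * T)) = S * (L * E) * (U * T)"
    using assms by (intro assoc_mult_mat[of _ m m _ n _ n, symmetric]) auto
  also have "S * (L * E) = S * L * E"
    using assms by (intro assoc_mult_mat[of _ m m _ m _ n, symmetric]) auto
  finally show ?thesis .
qed

text \<open>
  A nonzero entry is moved to the upper left corner and used to clear its row and column; induction
  applies to the remaining block.
\<close>

lemma rank_normal_form:
  fixes A :: "'a::field mat"
  assumes "A \<in> carrier_mat m n"
  shows "\<exists>P Q r. P \<in> carrier_mat m m \<and> det P \<noteq> 0 \<and> Q \<in> carrier_mat n n \<and> det Q \<noteq> 0 \<and>
    r \<le> m \<and> r \<le> n \<and> A = P * unit_block m n r * Q"
  using assms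
proof (induction m arbitrary: n A)
  case 0
  then have "A = 1\<^sub>m 0 * unit_block 0 n 0 * 1\<^sub>m n" by (intro eq_matI) auto
  then show ?case by (intro exI[of _ "1\<^sub>m 0"] exI[of _ "1\<^sub>m n"] exI[of _ 0]) simp
next
  case (Suc m)
  show ?case
  proof (cases "A = 0\<^sub>m (Suc m) n")
    case True
    moreover have "unit_block (Suc m) n 0 = (0\<^sub>m (Suc m) n :: 'a mat)"
      by (intro eq_matI) (auto simp: unit_block_def)
    ultimately have "A = 1\<^sub>m (Suc m) * unit_block (Suc m) n 0 * 1\<^sub>m n" by simp
    then show ?thesis by (intro exI[of _ "1\<^sub>m (Suc m)"] exI[of _ "1\<^sub>m n"] exI[of _ 0]) simp
  next
    case False
    then obtain i j where ij: "i < Suc m" "j < n" "A $$ (i, j) \<noteq> 0"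
      using Suc.prems by (metis eq_matI carrier_matD index_zero_mat)
    then obtain n' where n: "n = Suc n'" by (cases n) auto
    let ?S = "swaprows_mat (Suc m) 0 i :: 'a mat" and ?S' = "swaprows_mat n 0 j :: 'a mat"
    define A1 where "A1 = ?S * A * ?S'"
    have A1c: "A1 \<in> carrier_mat (Suc m) n" using Suc.prems by (auto simp: A1_def)
    have "A1 = swapcols 0 j (swaprows 0 i A)"
      unfolding A1_def using Suc.prems ij n
        swapcols_mat[OF mult_carrier_mat[OF swaprows_mat_carrier Suc.prems], of 0 j]
      by (simp add: swaprows_mat[of _ "Suc m" n])
    then have A100: "A1 $$ (0, 0) = A $$ (i, j)"
      using Suc.prems ij n by auto
    have "?S * A1 * ?S' = (?S * ?S) * A * (?S' * ?S')"
      unfolding A1_def using Suc.prems by (intro mult_mat_regroup) auto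
    then have A: "A = ?S * A1 * ?S'"
      using Suc.prems ij n by (simp add: swaprows_mat_inv)
    obtain a b c d where sb: "split_block A1 1 1 = (a, b, c, d)" by (metis prod_cases4)
    have blocks: "a \<in> carrier_mat 1 1" "b \<in> carrier_mat 1 n'" "c \<in> carrier_mat m 1" "d \<in> carrier_mat m n'"
      and A1: "A1 = four_block_mat a b c d"
      using split_block[OF sb, of m n'] A1c n by auto
    have a00: "a $$ (0, 0) \<noteq> 0" using A100 ij blocks unfolding A1 by simp
    define a' where "a' = mat 1 1 (\<lambda>_. inverse (a $$ (0, 0)))"
    have a'c: "a' \<in> carrier_mat 1 1" by (simp add: a'_def)
    have aa': "a * a' = 1\<^sub>m 1" "a' * a = 1\<^sub>m 1"
      using blocks a00 by (intro eq_matI; simp add: a'_def scalar_prod_def)+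
    \<comment> \<open>The Schur complement of the pivot.\<close>
    define d' where "d' = d - c * a' * b"
    have d'c: "d' \<in> carrier_mat m n'" using blocks a'c by (auto simp: d'_def)
    obtain P Q r where PQ: "P \<in> carrier_mat m m" "det P \<noteq> 0" "Q \<in> carrier_mat n' n'" "det Q \<noteq> 0"
      "r \<le> m" "r \<le> n'" "d' = P * unit_block m n' r * Q"
      using Suc.IH[OF d'c] by blast
    let ?L = "four_block_mat a (0\<^sub>m 1 m) c P" and ?U = "four_block_mat (1\<^sub>m 1) (a' * b) (0\<^sub>m n' 1) Q"
    let ?E = "four_block_mat (1\<^sub>m 1) (0\<^sub>m 1 n') (0\<^sub>m m 1) (unit_block m n' r)"
    have E: "unit_block (Suc m) n (Suc r) = ?E"
      by (intro eq_matI) (auto simp: unit_block_def n)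
    have "?L * ?E = four_block_mat a (0\<^sub>m 1 n') c (P * unit_block m n' r)"
      using blocks PQ
      by (subst mult_four_block_mat[of _ 1 1 _ m _ m _ _ 1 _ n']) auto
    then have "?L * ?E * ?U = four_block_mat a (0\<^sub>m 1 n') c (P * unit_block m n' r) * ?U" by simp
    also have "\<dots> = four_block_mat a (a * (a' * b)) c (c * (a' * b) + d')"
      using blocks PQ a'c
      by (subst mult_four_block_mat[of _ 1 1 _ n' _ m _ _ 1 _ n']) auto
    also have "a * (a' * b) = b"
      using assoc_mult_mat[OF blocks(1) a'c blocks(2)] aa' blocks by simp
    also have "c * (a' * b) + d' = d"
      unfolding d'_def assoc_mult_mat[OF blocks(3) a'c blocks(2)]
      using blocks a'c by (intro eq_matI) auto
    finally have "A1 = ?L * unit_block (Suc m) n (Suc r) * ?U" by (simp add: A1 E)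
    then have "A = ?S * (?L * unit_block (Suc m) n (Suc r) * ?U) * ?S'" using A by simp
    also have "\<dots> = (?S * ?L) * unit_block (Suc m) n (Suc r) * (?U * ?S')"
    proof -
      have "?L \<in> carrier_mat (Suc m) (Suc m)" "?U \<in> carrier_mat n n" using blocks PQ n by auto
      then show ?thesis by (intro mult_mat_regroup) auto
    qed
    finally have "A = (?S * ?L) * unit_block (Suc m) n (Suc r) * (?U * ?S')" .
    moreover have "det (?S * ?L) \<noteq> 0"
    proof -
      have "det ?L = det a * det P" using blocks PQ by (intro det_four_block_mat_upper_right_zero[of _ 1 _ m]) auto
      moreover have "det a \<noteq> 0" using a00 blocks by (simp add: det_single)
      moreover have "det (?S * ?L) = det ?S * det ?L" using blocks PQ by (intro det_mult) auto
      ultimately show ?thesis using PQ det_swaprows_mat_nonzero[of 0 "Suc m" i] ij by simp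
    qed
    moreover have "det (?U * ?S') \<noteq> 0"
    proof -
      have "det ?U = det (1\<^sub>m 1) * det Q" using blocks a'c PQ by (intro det_four_block_mat_lower_left_zero[of _ 1 _ n']) auto
      moreover have "det (?U * ?S') = det ?U * det ?S'" using blocks PQ n by (intro det_mult) auto
      ultimately show ?thesis using PQ det_swaprows_mat_nonzero[of 0 n j] ij n by simp
    qed
    moreover have "?S * ?L \<in> carrier_mat (Suc m) (Suc m)" "?U * ?S' \<in> carrier_mat n n"
      using blocks PQ n by auto
    ultimately show ?thesis using PQ(5,6) n
      by (intro exI[of _ "?S * ?L"] exI[of _ "?U * ?S'"] exI[of _ "Suc r"]) simp
  qed
qed

section \<open>Counting matrices in an affine family by rank\<close>

text \<open>
  The first \<open>i\<close> columns of \<open>A + B * unit_block n n i\<close> are those of \<open>A + B\<close> and the others are those of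
  \<open>A\<close>. So the first \<open>i\<close> columns of \<open>A + B\<close> form an extension of the fixed columns, and the remaining
  \<open>n - i\<close> columns of \<open>A + B\<close> are free.
\<close>

lemma card_rank_add_eq_card_extensions:
  fixes A :: "'a::{field, finite} mat" and n i j :: nat
  defines "q \<equiv> card (UNIV :: 'a set)"
  defines "ws \<equiv> drop i (cols A)"
  assumes A: "A \<in> carrier_mat n n" and i: "i \<le> n"
  shows "card {B \<in> carrier_mat n n. card (mat_range (A + B * unit_block n n i)) = q ^ j} =
    card (extensions n ws i j) * q ^ (n * (n - i))"
proof -
  have ws: "set ws \<subseteq> carrier_vec n" "length ws = n - i"
    using cols_dim[of A] A set_drop_subset[of i "cols A"] by (auto simp: ws_def)
  \<comment> \<open>\<open>\<phi>\<close> recovers \<open>B\<close> from the columns of \<open>A + B\<close>.\<close>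
  define \<phi> where "\<phi> = (\<lambda>(xs, ys). mat_of_cols n (xs @ ys) - A)"
  have \<phi>: "\<phi> p \<in> carrier_mat n n" for p
    using A by (simp add: \<phi>_def case_prod_unfold minus_carrier_mat)
  have \<phi>_add: "A + \<phi> (xs, ys) * unit_block n n i = mat_of_cols n (xs @ ws)"
    if xs: "xs \<in> col_lists n i" and ys: "ys \<in> col_lists n (n - i)" for xs ys
  proof (rule eq_matI)
    fix r c assume "r < dim_row (mat_of_cols n (xs @ ws))" "c < dim_col (mat_of_cols n (xs @ ws))"
    then have rc: "r < n" "c < n" using xs ws i by (auto simp: col_lists_def)
    have "(A + \<phi> (xs, ys) * unit_block n n i) $$ (r, c) = A $$ (r, c) + (if c < i then \<phi> (xs, ys) $$ (r, c) else 0)"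
      using A rc i index_mult_unit_block[OF \<phi> i rc] by (simp add: carrier_matD[OF \<phi>] del: index_mult_mat(1))
    also have "\<dots> = mat_of_cols n (xs @ ws) $$ (r, c)"
      using A rc i xs ys ws(2) by (auto simp: \<phi>_def mat_of_cols_index nth_append col_lists_def) (simp add: ws_def)
    finally show "(A + \<phi> (xs, ys) * unit_block n n i) $$ (r, c) = mat_of_cols n (xs @ ws) $$ (r, c)" .
  qed (use A \<phi>[of "(xs, ys)"] xs ws i in \<open>auto simp: col_lists_def\<close>)
  have \<phi>_inv: "\<phi> (take i (cols (B + A)), drop i (cols (B + A))) = B" if B: "B \<in> carrier_mat n n" for B
  proof -
    have "mat_of_cols n (cols (B + A)) = B + A" using A B mat_of_cols_cols[of "B + A"] by simp
    then have "\<phi> (take i (cols (B + A)), drop i (cols (B + A))) = B + A - A" by (simp add: \<phi>_def)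
    also have "\<dots> = B" using A B by (intro eq_matI) auto
    finally show ?thesis .
  qed
  have lists: "take i (cols (B + A)) \<in> col_lists n i" "drop i (cols (B + A)) \<in> col_lists n (n - i)"
    if B: "B \<in> carrier_mat n n" for B
  proof -
    have "set (cols (B + A)) \<subseteq> carrier_vec n" "length (cols (B + A)) = n"
      using cols_dim[of "B + A"] A B by auto
    then show "take i (cols (B + A)) \<in> col_lists n i" "drop i (cols (B + A)) \<in> col_lists n (n - i)"
      using i set_take_subset[of i "cols (B + A)"] set_drop_subset[of i "cols (B + A)"]
      unfolding col_lists_def by simp_all
  qed
  have "bij_betw \<phi> (extensions n ws i j \<times> (col_lists n (n - i) :: 'a vec list set))
    {B \<in> carrier_mat n n. card (mat_range (A + B * unit_block n n i)) = q ^ j}" (is "bij_betw _ ?X ?Y")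
  proof (rule bij_betw_byWitness[of _ "\<lambda>B. (take i (cols (B + A)), drop i (cols (B + A)))"])
    show "\<forall>p\<in>?X. (take i (cols (\<phi> p + A)), drop i (cols (\<phi> p + A))) = p"
    proof (clarify)
      fix xs ys :: "'a vec list" assume "xs \<in> extensions n ws i j" and ys: "ys \<in> col_lists n (n - i)"
      then have xs: "xs \<in> col_lists n i" by (simp add: extensions_def)
      have "\<phi> (xs, ys) + A = mat_of_cols n (xs @ ys)"
        using A xs ys i by (intro eq_matI) (auto simp: \<phi>_def col_lists_def)
      moreover have "cols (mat_of_cols n (xs @ ys)) = xs @ ys"
        using xs ys by (intro cols_mat_of_cols) (simp add: col_lists_def)
      ultimately show "take i (cols (\<phi> (xs, ys) + A)) = xs \<and> drop i (cols (\<phi> (xs, ys) + A)) = ys"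
        using xs by (simp add: col_lists_def)
    qed
    show "\<forall>B\<in>?Y. \<phi> (take i (cols (B + A)), drop i (cols (B + A))) = B"
      using \<phi>_inv by blast
    show "\<phi> ` ?X \<subseteq> ?Y"
    proof clarify
      fix xs ys :: "'a vec list" assume xs: "xs \<in> extensions n ws i j" and ys: "ys \<in> col_lists n (n - i)"
      then have xs': "xs \<in> col_lists n i" by (simp add: extensions_def)
      show "\<phi> (xs, ys) \<in> carrier_mat n n \<and> card (mat_range (A + \<phi> (xs, ys) * unit_block n n i)) = q ^ j"
        using xs \<phi> unfolding \<phi>_add[OF xs' ys]
        by (simp add: extensions_def q_def)
    qed
    show "(\<lambda>B. (take i (cols (B + A)), drop i (cols (B + A)))) ` ?Y \<subseteq> ?X"
    proof clarify
      fix B assume B: "B \<in> carrier_mat n n" and rk: "card (mat_range (A + B * unit_block n n i)) = q ^ j"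
      show "take i (cols (B + A)) \<in> extensions n ws i j \<and> drop i (cols (B + A)) \<in> col_lists n (n - i)"
        using \<phi>_add[OF lists[OF B]] lists[OF B] rk unfolding \<phi>_inv[OF B]
        by (simp add: extensions_def q_def)
    qed
  qed
  then have "card {B \<in> carrier_mat n n. card (mat_range (A + B * unit_block n n i)) = q ^ j} =
      card (extensions n ws i j) * card (col_lists n (n - i) :: 'a vec list set)"
    by (simp add: bij_betw_same_card[symmetric] card_cartesian_product)
  then show "card {B \<in> carrier_mat n n. card (mat_range (A + B * unit_block n n i)) = q ^ j} =
      card (extensions n ws i j) * q ^ (n * (n - i))"
    by (simp add: card_col_lists(2) q_def)
qed

text \<open>
  The hypothesis \<open>ker\<close> says that \<open>A\<close> is injective on the vectors supported on the last \<open>n - i\<close>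
  coordinates, that is, that the last \<open>n - i\<close> columns of \<open>A\<close> are independent.
\<close>

lemma card_mat_range_drop_cols:
  fixes A :: "'a::{field, finite} mat" and n i j :: nat
  defines "ws \<equiv> drop i (cols A)"
  assumes A: "A \<in> carrier_mat n n" and i: "i \<le> n"
    and ker: "\<And>x. x \<in> carrier_vec n \<Longrightarrow> A *\<^sub>v x = 0\<^sub>v n \<Longrightarrow> (\<And>k. k < i \<Longrightarrow> x $ k = 0) \<Longrightarrow> x = 0\<^sub>v n"
  shows "card (mat_range (mat_of_cols n ws)) = card (UNIV :: 'a set) ^ (n - i)"
proof -
  have ws: "length ws = n - i" using A by (simp add: ws_def)
    have inj: "x = y" if x: "x \<in> carrier_vec (n - i)" and y: "y \<in> carrier_vec (n - i)"
      and eq: "mat_of_cols n ws *\<^sub>v x = mat_of_cols n ws *\<^sub>v y" for x y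
    proof -
      \<comment> \<open>A collision of \<open>x\<close> and \<open>y\<close> yields a vector on which \<open>A\<close> and the first \<open>i\<close> coordinates vanish.\<close>
      define z where "z = 0\<^sub>v i @\<^sub>v (x - y)"
      have "z \<in> carrier_vec (i + (n - i))" unfolding z_def using x y by (intro append_carrier_vec) auto
      then have z: "z \<in> carrier_vec n" using i by simp
      have zk: "z $ k = (if k < i then 0 else x $ (k - i) - y $ (k - i))" if "k < n" for k
        using that x y i unfolding z_def by simp
      have "A *\<^sub>v z = 0\<^sub>v n"
      proof (rule eq_vecI)
        fix r assume "r < dim_vec (0\<^sub>v n :: 'a vec)"
        then have r: "r < n" by simp
        have "(A *\<^sub>v z) $ r = (\<Sum>k<n. A $$ (r, k) * z $ k)"
          using A z r by (auto simp: scalar_prod_def atLeast0LessThan intro!: sum.cong)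
        also have "\<dots> = (\<Sum>k\<in>{i..<n}. A $$ (r, k) * (x $ (k - i) - y $ (k - i)))"
          by (intro sum.mono_neutral_cong_right) (auto simp: zk)
        also have "\<dots> = (\<Sum>k<n - i. A $$ (r, k + i) * (x $ k - y $ k))"
          using i by (intro sum.reindex_bij_witness[of _ "\<lambda>k. k + i" "\<lambda>k. k - i"]) auto
        also have "\<dots> = (\<Sum>k<n - i. mat_of_cols n ws $$ (r, k) * x $ k) - (\<Sum>k<n - i. mat_of_cols n ws $$ (r, k) * y $ k)"
          unfolding sum_subtractf[symmetric]
        proof (intro sum.cong refl)
          fix k assume "k \<in> {..<n - i}"
          then have "mat_of_cols n ws $$ (r, k) = A $$ (r, k + i)"
            using A r ws by (simp add: mat_of_cols_index ws_def add.commute)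
          then show "A $$ (r, k + i) * (x $ k - y $ k) = mat_of_cols n ws $$ (r, k) * x $ k - mat_of_cols n ws $$ (r, k) * y $ k"
            by (simp add: right_diff_distrib)
        qed
        also have "\<dots> = (mat_of_cols n ws *\<^sub>v x) $ r - (mat_of_cols n ws *\<^sub>v y) $ r"
          using x y r ws by (simp add: scalar_prod_def atLeast0LessThan)
        finally show "(A *\<^sub>v z) $ r = 0\<^sub>v n $ r" using eq r by simp
      qed (use A in simp)
      then have "z = 0\<^sub>v n"
      proof (rule ker[OF z])
        fix k assume "k < i"
        then show "z $ k = 0" using zk[of k] i by simp
      qed
      show "x = y"
      proof (rule eq_vecI)
        fix k assume "k < dim_vec y"
        then have "k < n - i" using y by simp
        then show "x $ k = y $ k"
          using zk[of "k + i"] \<open>z = 0\<^sub>v n\<close> by simp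
      qed (use x y in simp)
    qed
    have "inj_on (\<lambda>x. mat_of_cols n ws *\<^sub>v x) (carrier_vec (n - i))"
      using inj by (rule inj_onI)
    then show ?thesis
      unfolding mat_range_def using ws by (simp add: card_image card_carrier_vec)
qed

lemma card_rank_add_mult_unit_block:
  fixes A :: "'a::{field, finite} mat" and n i j :: nat
  defines "q \<equiv> card (UNIV :: 'a set)"
  assumes A: "A \<in> carrier_mat n n" and i: "i \<le> n"
    and ker: "\<And>x. x \<in> carrier_vec n \<Longrightarrow> A *\<^sub>v x = 0\<^sub>v n \<Longrightarrow> (\<And>k. k < i \<Longrightarrow> x $ k = 0) \<Longrightarrow> x = 0\<^sub>v n"
  shows "(of_nat (card {B \<in> carrier_mat n n. card (mat_range (A + B * unit_block n n i)) = q ^ j}) :: complex) =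
    (if n \<le> i + j then of_nat q ^ (n\<^sup>2 - i\<^sup>2) *
      (gauss_binomial (of_nat q) i (i + j - n) * q_falling (of_nat q) (i + j - n) (of_nat q ^ i)) else 0)"
proof -
  let ?q = "of_nat q :: complex"
  define ws where "ws = drop i (cols A)"
  have ws: "set ws \<subseteq> carrier_vec n"
    using cols_dim[of A] A set_drop_subset[of i "cols A"] by (auto simp: ws_def)
  note count = card_rank_add_eq_card_extensions[OF A i, of j, folded q_def ws_def]
  have rank_ws: "card (mat_range (mat_of_cols n ws)) = q ^ (n - i)"
    unfolding ws_def q_def using ker by (rule card_mat_range_drop_cols[OF A i])
  show ?thesis
  proof (cases "n \<le> i + j")
    case False
    then have "extensions n ws i j = {}"
      using rank_ws unfolding q_def by (intro extensions_below[OF ws, of "n - i"]) auto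
    with False show ?thesis by (simp add: count)
  next
    case True
    define t where "t = i + j - n"
    have j: "j = n - i + t" using True i by (simp add: t_def)
    have ext: "of_nat (card (extensions n ws i j)) =
        gauss_binomial ?q i t * (\<Prod>u<t. ?q ^ n - ?q ^ (n - i + u)) * ?q ^ ((n - i) * (i - t))"
      unfolding j using rank_ws unfolding q_def by (rule card_extensions[OF ws])
    have "(\<Prod>u<t. ?q ^ n - ?q ^ (n - i + u)) = (\<Prod>u<t. ?q ^ (n - i) * (?q ^ i - ?q ^ u))"
      using i by (intro prod.cong refl) (simp add: right_diff_distrib flip: power_add)
    also have "\<dots> = ?q ^ ((n - i) * t) * q_falling ?q t (?q ^ i)"
      by (simp add: prod.distrib q_falling_def power_mult)
    finally have prod: "(\<Prod>u<t. ?q ^ n - ?q ^ (n - i + u)) = ?q ^ ((n - i) * t) * q_falling ?q t (?q ^ i)" .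
    have pow: "gauss_binomial ?q i t * (?q ^ ((n - i) * t) * ?q ^ ((n - i) * (i - t)) * ?q ^ (n * (n - i))) =
       gauss_binomial ?q i t * ?q ^ (n\<^sup>2 - i\<^sup>2)"
    proof (cases "t \<le> i")
      case True
      have "(n - i) * t + (n - i) * (i - t) + n * (n - i) = n\<^sup>2 - i\<^sup>2"
      proof -
        obtain d where d: "n = i + d" using i by (rule less_eqE)
        obtain e where e: "i = t + e" using True by (rule less_eqE)
        have "n\<^sup>2 - i\<^sup>2 = d * (2 * i + d)" unfolding d by (simp add: power2_eq_square algebra_simps)
        also have "\<dots> = d * t + d * e + (i + d) * d" unfolding e by (simp add: algebra_simps)
        finally show ?thesis using d e by simp
      qed
      then show ?thesis by (simp only: power_add[symmetric])
    next
      case False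
      then have "gauss_binomial ?q i t = 0" by (simp add: gauss_binomial_eq_0)
      then show ?thesis by (simp only: mult_zero_left)
    qed
    have "of_nat (card {B \<in> carrier_mat n n. card (mat_range (A + B * unit_block n n i)) = q ^ j}) =
      gauss_binomial ?q i t * (?q ^ ((n - i) * t) * ?q ^ ((n - i) * (i - t)) * ?q ^ (n * (n - i))) * q_falling ?q t (?q ^ i)"
      unfolding count of_nat_mult ext prod of_nat_power by (simp only: mult_ac)
    also have "\<dots> = ?q ^ (n\<^sup>2 - i\<^sup>2) * (gauss_binomial ?q i t * q_falling ?q t (?q ^ i))"
      unfolding pow by (simp only: mult_ac)
    finally show ?thesis using True by (simp add: t_def)
  qed
qed

text \<open>
  The normal form \<open>c = P * unit_block n n r * Q\<close> reduces this to the case \<open>c = unit_block n n r\<close>: \<open>Q\<close> is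
  absorbed into \<open>a\<close> and does not change column spaces, and \<open>B \<mapsto> B * P\<close> permutes the matrices \<open>B\<close>.
\<close>

lemma card_rank_add_mult:
  fixes a c :: "'a::{field, finite} mat" and n j r :: nat
  defines "q \<equiv> card (UNIV :: 'a set)"
  assumes a: "a \<in> carrier_mat n n" and c: "c \<in> carrier_mat n n"
    and ker: "\<And>x. x \<in> carrier_vec n \<Longrightarrow> a *\<^sub>v x = 0\<^sub>v n \<Longrightarrow> c *\<^sub>v x = 0\<^sub>v n \<Longrightarrow> x = 0\<^sub>v n"
    and rank: "card (mat_range c) = q ^ r" and r: "r \<le> n"
  shows "(of_nat (card {B \<in> carrier_mat n n. card (mat_range (a + B * c)) = q ^ j}) :: complex) =
    (if n \<le> r + j then of_nat q ^ (n\<^sup>2 - r\<^sup>2) *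
      (gauss_binomial (of_nat q) r (r + j - n) * q_falling (of_nat q) (r + j - n) (of_nat q ^ r)) else 0)"
proof -
  obtain P Q s where PQ: "P \<in> carrier_mat n n" "det P \<noteq> 0" "Q \<in> carrier_mat n n" "det Q \<noteq> 0"
    "s \<le> n" "c = P * unit_block n n s * Q"
    using rank_normal_form[OF c] by blast
  have "mat_range c = mat_range (P * unit_block n n s)"
    unfolding PQ(6) using PQ by (intro mat_range_mult_right[of _ n n]) simp_all
  then have "card (mat_range c) = card (mat_range (unit_block n n s :: 'a mat))"
    using card_mat_range_mult_left[of "unit_block n n s" n n P] PQ by simp
  also have "\<dots> = q ^ s" unfolding q_def using PQ(5) by (rule card_mat_range_unit_block)
  finally have s: "s = r" unfolding rank q_def power_card_UNIV_inject ..
  let ?E = "unit_block n n r :: 'a mat"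
  note c_eq = PQ(6)[unfolded s]
  obtain P' where P': "P' \<in> carrier_mat n n" "P * P' = 1\<^sub>m n" "P' * P = 1\<^sub>m n"
    using inverse_if_det_nonzero[OF PQ(1,2)] by blast
  obtain Q' where Q': "Q' \<in> carrier_mat n n" "Q * Q' = 1\<^sub>m n" "Q' * Q = 1\<^sub>m n"
    using inverse_if_det_nonzero[OF PQ(3,4)] by blast
  have aQ: "a * Q' \<in> carrier_mat n n" using a Q' by simp
  have range_eq: "mat_range (a + B * c) = mat_range (a * Q' + (B * P) * ?E)" if B: "B \<in> carrier_mat n n" for B
  proof -
    have aQQ: "a = a * Q' * Q"
      using assoc_mult_mat[OF a Q'(1) PQ(3)] Q'(3) a by simp
    have Bc: "B * c = (B * P) * ?E * Q"
    proof -
      have "B * c = B * (P * ?E) * Q"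
        unfolding c_eq using PQ B by (intro assoc_mult_mat[of _ n n _ n _ n, symmetric]) simp_all
      also have "B * (P * ?E) = B * P * ?E"
        using PQ B by (intro assoc_mult_mat[of _ n n _ n _ n, symmetric]) simp_all
      finally show ?thesis .
    qed
    have BPE: "B * P * ?E \<in> carrier_mat n n"
      by (rule mult_carrier_mat[OF mult_carrier_mat[OF B PQ(1)] unit_block_carrier])
    have "a + B * c = a * Q' * Q + (B * P) * ?E * Q" unfolding Bc aQQ[symmetric] ..
    also have "\<dots> = (a * Q' + (B * P) * ?E) * Q"
      by (rule add_mult_distrib_mat[OF aQ BPE PQ(3), symmetric])
    finally show ?thesis
      using mat_range_mult_right[OF add_carrier_mat[OF BPE] PQ(3,4), of "a * Q'"] by (rule trans[OF arg_cong])
  qed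
  have "bij_betw (\<lambda>B. B * P) {B \<in> carrier_mat n n. card (mat_range (a + B * c)) = q ^ j}
    {B \<in> carrier_mat n n. card (mat_range (a * Q' + B * ?E)) = q ^ j}" (is "bij_betw _ ?X ?Y")
  proof (rule bij_betw_byWitness[of _ "\<lambda>B. B * P'"])
    have PP: "B * P * P' = B" "B * P' * P = B" if "B \<in> carrier_mat n n" for B
      using assoc_mult_mat[OF that PQ(1) P'(1)] assoc_mult_mat[OF that P'(1) PQ(1)] P' that by simp_all
    show "\<forall>B\<in>?X. B * P * P' = B" "\<forall>B\<in>?Y. B * P' * P = B" using PP by blast+
    show "(\<lambda>B. B * P) ` ?X \<subseteq> ?Y"
    proof clarify
      fix B assume B: "B \<in> carrier_mat n n" and "card (mat_range (a + B * c)) = q ^ j"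
      then show "B * P \<in> carrier_mat n n \<and> card (mat_range (a * Q' + B * P * ?E)) = q ^ j"
        unfolding range_eq[OF B] using mult_carrier_mat[OF B PQ(1)] by blast
    qed
    show "(\<lambda>B. B * P') ` ?Y \<subseteq> ?X"
    proof clarify
      fix B assume B: "B \<in> carrier_mat n n" and rk: "card (mat_range (a * Q' + B * ?E)) = q ^ j"
      have BP': "B * P' \<in> carrier_mat n n" using B P'(1) by (rule mult_carrier_mat)
      with rk show "B * P' \<in> carrier_mat n n \<and> card (mat_range (a + B * P' * c)) = q ^ j"
        unfolding range_eq[OF BP'] PP(2)[OF B] by blast
    qed
  qed
  then have "card ?X = card ?Y" by (rule bij_betw_same_card)
  moreover have "of_nat (card ?Y) = (if n \<le> r + j then of_nat q ^ (n\<^sup>2 - r\<^sup>2) *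
      (gauss_binomial (of_nat q) r (r + j - n) * q_falling (of_nat q) (r + j - n) (of_nat q ^ r)) else 0 :: complex)"
    unfolding q_def
  proof (rule card_rank_add_mult_unit_block[OF aQ r])
    fix x :: "'a vec"
    assume x: "x \<in> carrier_vec n" and ax: "a * Q' *\<^sub>v x = 0\<^sub>v n" and xk: "\<And>k. k < r \<Longrightarrow> x $ k = 0"
    have y: "Q' *\<^sub>v x \<in> carrier_vec n" using Q' x by simp
    have Qy: "Q *\<^sub>v (Q' *\<^sub>v x) = x"
      using assoc_mult_mat_vec[OF PQ(3) Q'(1) x] Q'(2) x by simp
    have "?E *\<^sub>v x = 0\<^sub>v n"
    proof (rule eq_vecI)
      fix i assume "i < dim_vec (0\<^sub>v n :: 'a vec)"
      then have i: "i < n" by simp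
      have "(?E *\<^sub>v x) $ i = (\<Sum>k<n. ?E $$ (i, k) * x $ k)"
        using i x by (auto simp: scalar_prod_def atLeast0LessThan intro!: sum.cong)
      also have "\<dots> = (\<Sum>k<n. 0)"
        using i xk by (intro sum.cong) (auto simp: unit_block_def)
      finally show "(?E *\<^sub>v x) $ i = 0\<^sub>v n $ i" using i by simp
    qed simp
    then have "P * ?E *\<^sub>v x = P *\<^sub>v 0\<^sub>v n"
      using PQ x by (subst assoc_mult_mat_vec[of _ n n _ n]) simp_all
    moreover have "P *\<^sub>v 0\<^sub>v n = 0\<^sub>v n"
      using PQ(1) by (intro eq_vecI) (auto simp: scalar_prod_def)
    moreover have "c *\<^sub>v (Q' *\<^sub>v x) = P * ?E *\<^sub>v x"
      unfolding c_eq using assoc_mult_mat_vec[of "P * ?E" n n Q n "Q' *\<^sub>v x"] PQ y Qy by simp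
    ultimately have cy: "c *\<^sub>v (Q' *\<^sub>v x) = 0\<^sub>v n" by simp
    have ay: "a *\<^sub>v (Q' *\<^sub>v x) = 0\<^sub>v n"
      using assoc_mult_mat_vec[OF a Q'(1) x] ax by simp
    have "Q' *\<^sub>v x = 0\<^sub>v n" using y ay cy by (rule ker)
    moreover have "Q *\<^sub>v 0\<^sub>v n = 0\<^sub>v n"
      using PQ(3) by (intro eq_vecI) (auto simp: scalar_prod_def)
    ultimately show "x = 0\<^sub>v n" using Qy by simp
  qed
  ultimately show ?thesis by simp
qed

section \<open>Double cosets of the Siegel parabolic\<close>

definition lower_left :: "nat \<Rightarrow> 'a mat \<Rightarrow> 'a mat" where
  "lower_left n g = mat n n (\<lambda>(i, j). g $$ (i + n, j))"

lemma lower_left_carrier [simp]: "lower_left n g \<in> carrier_mat n n"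
  by (simp add: lower_left_def)

lemma lower_left_four_block:
  assumes "A \<in> carrier_mat n n" "C \<in> carrier_mat n n" "D \<in> carrier_mat n n"
  shows "lower_left n (four_block_mat A B C D) = C"
  using assms unfolding lower_left_def by (intro eq_matI) auto

lemma square_blocks:
  assumes "g \<in> carrier_mat (2 * n) (2 * n)"
  obtains a b c d where "a \<in> carrier_mat n n" "b \<in> carrier_mat n n" "c \<in> carrier_mat n n" "d \<in> carrier_mat n n"
    "g = four_block_mat a b c d" "lower_left n g = c"
proof -
  obtain a b c d where sb: "split_block g n n = (a, b, c, d)" by (metis prod_cases4)
  have "dim_row g = n + n" "dim_col g = n + n" using assms by auto
  note blocks = split_block[OF sb this]
  show ?thesis using that[OF blocks] lower_left_four_block[OF blocks(1,3,4), of b] blocks(5) by simp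
qed

lemma SL_carrier: "g \<in> SL m \<Longrightarrow> g \<in> carrier_mat m m"
  by (simp add: SL_def)

lemma SL_mult: "g \<in> SL m \<Longrightarrow> h \<in> SL m \<Longrightarrow> g * h \<in> SL m"
  by (auto simp: SL_def det_mult)

lemma SL_inverse:
  assumes "g \<in> SL m"
  obtains h where "h \<in> SL m" "g * h = 1\<^sub>m m" "h * g = 1\<^sub>m m"
proof -
  have g: "g \<in> carrier_mat m m" "det g = 1" using assms by (auto simp: SL_def)
  obtain h where "h \<in> carrier_mat m m" "g * h = 1\<^sub>m m" "h * g = 1\<^sub>m m" "det g * det h = 1"
    using inverse_if_det_nonzero[OF g(1)] g(2) by auto
  then show ?thesis using that g by (simp add: SL_def)
qed

lemma siegel_parabolicI:
  fixes A :: "'a::field mat"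
  assumes "A \<in> carrier_mat n n" "B \<in> carrier_mat n n" "D \<in> carrier_mat n n" "det A * det D = 1"
  shows "four_block_mat A B (0\<^sub>m n n) D \<in> siegel_parabolic n"
  unfolding siegel_parabolic_def using assms det_mult[OF assms(1,3)] by auto

lemma siegel_parabolicE:
  fixes p :: "'a::field mat"
  assumes "p \<in> siegel_parabolic n"
  obtains A B D where "A \<in> carrier_mat n n" "B \<in> carrier_mat n n" "D \<in> carrier_mat n n"
    "p = four_block_mat A B (0\<^sub>m n n) D" "det A * det D = 1"
  using assms det_mult unfolding siegel_parabolic_def by (smt (verit) mem_Collect_eq)

lemma siegel_parabolic_SL: "p \<in> siegel_parabolic n \<Longrightarrow> p \<in> SL (2 * n)"
proof (erule siegel_parabolicE)
  fix A B D :: "'a mat"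
  assume "A \<in> carrier_mat n n" "B \<in> carrier_mat n n" "D \<in> carrier_mat n n" and p: "p = four_block_mat A B (0\<^sub>m n n) D"
    and det: "det A * det D = 1"
  then have "det p = 1" "p \<in> carrier_mat (n + n) (n + n)"
    using det_four_block_mat_lower_left_zero[of A n B n "0\<^sub>m n n" D] by auto
  then show "p \<in> SL (2 * n)" by (simp add: SL_def mult_2)
qed

lemma one_siegel_parabolic: "1\<^sub>m (2 * n) \<in> siegel_parabolic n"
  using siegel_parabolicI[of "1\<^sub>m n" n "0\<^sub>m n n" "1\<^sub>m n"] by (simp add: mult_2)

lemma siegel_parabolic_mult:
  fixes p :: "'a::field mat"
  assumes p: "p \<in> siegel_parabolic n" and p': "p' \<in> siegel_parabolic n"
  shows "p * p' \<in> siegel_parabolic n"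
proof -
  obtain A B D where p: "A \<in> carrier_mat n n" "B \<in> carrier_mat n n" "D \<in> carrier_mat n n"
    "p = four_block_mat A B (0\<^sub>m n n) D" "det A * det D = 1"
    using p by (rule siegel_parabolicE)
  obtain A' B' D' where p': "A' \<in> carrier_mat n n" "B' \<in> carrier_mat n n" "D' \<in> carrier_mat n n"
    "p' = four_block_mat A' B' (0\<^sub>m n n) D'" "det A' * det D' = 1"
    using p' by (rule siegel_parabolicE)
  have "p * p' = four_block_mat (A * A' + B * 0\<^sub>m n n) (A * B' + B * D') (0\<^sub>m n n * A' + D * 0\<^sub>m n n) (0\<^sub>m n n * B' + D * D')"
    unfolding p(4) p'(4) using p p' by (intro mult_four_block_mat[of _ n n _ n _ n _ _ n _ n]) auto
  then have "p * p' = four_block_mat (A * A') (A * B' + B * D') (0\<^sub>m n n) (D * D')"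
    using p p' by simp
  moreover have "det (A * A') * det (D * D') = (det A * det D) * (det A' * det D')"
    using p(1,3) p'(1,3) by (simp add: det_mult mult_ac)
  then have "det (A * A') * det (D * D') = 1" unfolding p(5) p'(5) by simp
  ultimately show ?thesis using p p' by (simp add: siegel_parabolicI)
qed

text \<open>
  The lower left block \<open>c\<close> of \<open>g\<close> becomes \<open>D * c * A'\<close> with \<open>D\<close> and \<open>A'\<close> invertible diagonal blocks of
  \<open>p\<close> and \<open>p'\<close>.
\<close>

lemma card_mat_range_lower_left:
  fixes g :: "'a::field mat"
  assumes p: "p \<in> siegel_parabolic n" and g: "g \<in> SL (2 * n)" and p': "p' \<in> siegel_parabolic n"
  shows "card (mat_range (lower_left n (p * g * p'))) = card (mat_range (lower_left n g))"
proof -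
  obtain A B D where p: "A \<in> carrier_mat n n" "B \<in> carrier_mat n n" "D \<in> carrier_mat n n"
    "p = four_block_mat A B (0\<^sub>m n n) D" "det A * det D = 1"
    using p by (rule siegel_parabolicE)
  obtain A' B' D' where p': "A' \<in> carrier_mat n n" "B' \<in> carrier_mat n n" "D' \<in> carrier_mat n n"
    "p' = four_block_mat A' B' (0\<^sub>m n n) D'" "det A' * det D' = 1"
    using p' by (rule siegel_parabolicE)
  obtain a b c d where g: "a \<in> carrier_mat n n" "b \<in> carrier_mat n n" "c \<in> carrier_mat n n" "d \<in> carrier_mat n n"
    "g = four_block_mat a b c d" "lower_left n g = c"
    using SL_carrier[OF g] by (rule square_blocks)
  have "p * g = four_block_mat (A * a + B * c) (A * b + B * d) (D * c) (D * d)"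
    unfolding p(4) g(5) using p g by (subst mult_four_block_mat[of _ n n _ n _ n _ _ n _ n]) auto
  then have "p * g * p' = four_block_mat ((A * a + B * c) * A' + (A * b + B * d) * 0\<^sub>m n n)
      ((A * a + B * c) * B' + (A * b + B * d) * D') (D * c * A' + D * d * 0\<^sub>m n n) (D * c * B' + D * d * D')"
    unfolding p'(4) using p p' g by (simp only:) (intro mult_four_block_mat[of _ n n _ n _ n _ _ n _ n]; simp)
  then have "lower_left n (p * g * p') = D * c * A' + D * d * 0\<^sub>m n n"
    using p p' g by (simp only:) (intro lower_left_four_block; simp)
  then have "lower_left n (p * g * p') = D * c * A'"
    using p p' g by simp
  moreover have "mat_range (D * c * A') = mat_range (D * c)"
    using p g p' by (intro mat_range_mult_right[of _ n n]) auto
  moreover have "card (mat_range (D * c)) = card (mat_range c)"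
    using p g by (intro card_mat_range_mult_left[of _ n n]) auto
  ultimately show ?thesis using g by simp
qed

text \<open>
  Right multiplication by the inverse of \<open>four_block_mat a b c d\<close> sends the lower rows \<open>c\<close>, \<open>d\<close> to those
  of the unit matrix, so the quotient of the two elements lies in the parabolic.
\<close>

lemma same_lower_rows_same_coset:
  fixes a b c d a' b' :: "'a::field mat"
  assumes blocks: "a \<in> carrier_mat n n" "b \<in> carrier_mat n n" "c \<in> carrier_mat n n" "d \<in> carrier_mat n n"
      "a' \<in> carrier_mat n n" "b' \<in> carrier_mat n n"
    and h: "four_block_mat a b c d \<in> SL (2 * n)"
    and h': "four_block_mat a' b' c d \<in> SL (2 * n)"
  shows "\<exists>p\<in>siegel_parabolic n. four_block_mat a' b' c d = p * four_block_mat a b c d"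
proof -
  let ?h = "four_block_mat a b c d" and ?h' = "four_block_mat a' b' c d"
  obtain W where W: "W \<in> SL (2 * n)" "?h * W = 1\<^sub>m (2 * n)" "W * ?h = 1\<^sub>m (2 * n)"
    using SL_inverse[OF h] by blast
  define p where "p = ?h' * W"
  have p: "p \<in> SL (2 * n)" unfolding p_def using h' W(1) by (rule SL_mult)
  have "p * ?h = ?h' * (W * ?h)"
    unfolding p_def using SL_carrier[OF h] SL_carrier[OF h'] SL_carrier[OF W(1)]
    by (intro assoc_mult_mat[of _ "2 * n" "2 * n" _ "2 * n" _ "2 * n"])
  then have ph: "?h' = p * ?h" using W right_mult_one_mat[OF SL_carrier[OF h']] by simp
  obtain A B C D where blocks': "A \<in> carrier_mat n n" "B \<in> carrier_mat n n" "C \<in> carrier_mat n n" "D \<in> carrier_mat n n"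
    "p = four_block_mat A B C D"
    using SL_carrier[OF p] by (rule square_blocks)
  have low: "p $$ (i + n, j) = 1\<^sub>m (2 * n) $$ (i + n, j)" if "i < n" "j < 2 * n" for i j
  proof -
    have "row ?h' (i + n) = row ?h (i + n)"
      using blocks that by (intro eq_vecI) auto
    then have "p $$ (i + n, j) = (?h * W) $$ (i + n, j)"
      unfolding p_def using that blocks SL_carrier[OF W(1)] by simp
    then show ?thesis using W by simp
  qed
  have "C = 0\<^sub>m n n"
  proof (rule eq_matI)
    fix i j assume "i < dim_row (0\<^sub>m n n :: 'a mat)" "j < dim_col (0\<^sub>m n n :: 'a mat)"
    then show "C $$ (i, j) = 0\<^sub>m n n $$ (i, j)"
      using low[of i j] blocks' by simp
  qed (use blocks' in auto)
  moreover have "D = 1\<^sub>m n"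
  proof (rule eq_matI)
    fix i j assume "i < dim_row (1\<^sub>m n :: 'a mat)" "j < dim_col (1\<^sub>m n :: 'a mat)"
    then show "D $$ (i, j) = 1\<^sub>m n $$ (i, j)"
      using low[of i "j + n"] blocks' by simp
  qed (use blocks' in auto)
  moreover have "det p = 1" using p by (simp add: SL_def)
  ultimately have "p \<in> siegel_parabolic n"
    using blocks' det_four_block_mat_lower_left_zero[of A n B n C D]
    by (auto intro!: siegel_parabolicI)
  with ph show ?thesis by blast
qed

definition drop_rows :: "nat \<Rightarrow> 'a mat \<Rightarrow> 'a mat" where
  "drop_rows r A = mat (dim_row A - r) (dim_col A) (\<lambda>(i, j). A $$ (i + r, j))"

lemma drop_rows_mult:
  assumes "r \<le> dim_row A" "dim_row B = dim_col A"
  shows "drop_rows r (A * B) = drop_rows r A * B"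
proof (rule eq_matI)
  fix i j assume "i < dim_row (drop_rows r A * B)" "j < dim_col (drop_rows r A * B)"
  then have ij: "i + r < dim_row A" "i < dim_row (drop_rows r A)" "j < dim_col B"
    by (auto simp: drop_rows_def)
  have "row (drop_rows r A) i = row A (i + r)"
    using ij by (intro eq_vecI) (auto simp: drop_rows_def)
  then show "drop_rows r (A * B) $$ (i, j) = (drop_rows r A * B) $$ (i, j)"
    using ij by (simp add: drop_rows_def[of r "A * B"])
qed (auto simp: drop_rows_def)

lemma block_diag_one_mult:
  assumes W: "W \<in> carrier_mat k k" and Y: "Y \<in> carrier_mat (r + k) m"
    and ij: "i < r + k" "j < m"
  shows "(four_block_mat (1\<^sub>m r) (0\<^sub>m r k) (0\<^sub>m k r) W * Y) $$ (i, j) =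
    (if i < r then Y $$ (i, j) else (W * drop_rows r Y) $$ (i - r, j :: nat) :: 'a::comm_ring_1)"
proof -
  obtain Y1 Y2 Y3 Y4 where sb: "split_block Y r m = (Y1, Y2, Y3, Y4)" by (metis prod_cases4)
  have Yc: "Y1 \<in> carrier_mat r m" "Y2 \<in> carrier_mat r 0" "Y3 \<in> carrier_mat k m" "Y4 \<in> carrier_mat k 0"
    and Yb: "Y = four_block_mat Y1 Y2 Y3 Y4"
    using split_block[OF sb, of k 0] Y by auto
  have "drop_rows r Y = Y3"
    unfolding Yb drop_rows_def using Yc by (intro eq_matI) auto
  moreover have "four_block_mat (1\<^sub>m r) (0\<^sub>m r k) (0\<^sub>m k r) W * Y =
    four_block_mat (1\<^sub>m r * Y1 + 0\<^sub>m r k * Y3) (1\<^sub>m r * Y2 + 0\<^sub>m r k * Y4)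
      (0\<^sub>m k r * Y1 + W * Y3) (0\<^sub>m k r * Y2 + W * Y4)"
    unfolding Yb using Yc W by (intro mult_four_block_mat[of _ r r _ k _ k _ _ m _ 0]) auto
  moreover have "Y $$ (i, j) = Y1 $$ (i, j)" if "i < r"
    using that ij Yc unfolding Yb by simp
  moreover have "1\<^sub>m r * Y1 + 0\<^sub>m r k * Y3 = Y1" "0\<^sub>m k r * Y1 + W * Y3 = W * Y3"
    using Yc W by simp_all
  ultimately show ?thesis using ij Yc W by (simp del: index_mult_mat(1))
qed

text \<open>
  Next to \<open>unit_block n n r\<close>, which has its nonzero entries in the first \<open>r\<close> rows, this completes an
  \<open>n \<times> 2 n\<close> matrix with independent rows.
\<close>

definition standard_lower_right :: "nat \<Rightarrow> nat \<Rightarrow> 'a::semiring_1 mat" where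
  "standard_lower_right n r = mat n n (\<lambda>(i, j). if r \<le> i \<and> j = i - r then 1 else 0)"

lemma standard_lower_right_carrier [simp]: "standard_lower_right n r \<in> carrier_mat n n"
  by (simp add: standard_lower_right_def)

text \<open>
  If \<open>c = P * unit_block n n r * Q\<close>, the block diagonal matrices with blocks \<open>P\<close> and \<open>P\<close> inverse, and
  \<open>Q\<close> inverse and \<open>Q\<close>, have determinant one for arbitrary determinants of \<open>P\<close> and \<open>Q\<close>.
\<close>

lemma reduce_lower_left:
  fixes g :: "'a::field mat"
  assumes g: "g \<in> SL (2 * n)"
  obtains p p' r where "p \<in> siegel_parabolic n" "p' \<in> siegel_parabolic n" "r \<le> n"
    "lower_left n (p * g * p') = unit_block n n r"
proof -
  obtain a b c d where blocks: "a \<in> carrier_mat n n" "b \<in> carrier_mat n n" "c \<in> carrier_mat n n" "d \<in> carrier_mat n n"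
    "g = four_block_mat a b c d" "lower_left n g = c"
    using SL_carrier[OF g] by (rule square_blocks)
  obtain P Q r where PQ: "P \<in> carrier_mat n n" "det P \<noteq> 0" "Q \<in> carrier_mat n n" "det Q \<noteq> 0"
    "r \<le> n" "c = P * unit_block n n r * Q"
    using rank_normal_form[OF blocks(3)] by blast
  obtain P' where P': "P' \<in> carrier_mat n n" "P * P' = 1\<^sub>m n" "P' * P = 1\<^sub>m n" "det P * det P' = 1"
    using inverse_if_det_nonzero[OF PQ(1,2)] by blast
  obtain Q' where Q': "Q' \<in> carrier_mat n n" "Q * Q' = 1\<^sub>m n" "Q' * Q = 1\<^sub>m n" "det Q * det Q' = 1"
    using inverse_if_det_nonzero[OF PQ(3,4)] by blast
  let ?p = "four_block_mat P (0\<^sub>m n n) (0\<^sub>m n n) P'" and ?p' = "four_block_mat Q' (0\<^sub>m n n) (0\<^sub>m n n) Q"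
  have "?p * g = four_block_mat (P * a + 0\<^sub>m n n * c) (P * b + 0\<^sub>m n n * d) (0\<^sub>m n n * a + P' * c) (0\<^sub>m n n * b + P' * d)"
    unfolding blocks(5) using PQ P' blocks by (intro mult_four_block_mat[of _ n n _ n _ n _ _ n _ n]) auto
  also have "\<dots> = four_block_mat (P * a) (P * b) (P' * c) (P' * d)"
    using PQ P' blocks by simp
  finally have "?p * g * ?p' = four_block_mat (P * a * Q' + P * b * 0\<^sub>m n n) (P * a * 0\<^sub>m n n + P * b * Q)
     (P' * c * Q' + P' * d * 0\<^sub>m n n) (P' * c * 0\<^sub>m n n + P' * d * Q)"
    using PQ P' Q' blocks by (simp only:) (intro mult_four_block_mat[of _ n n _ n _ n _ _ n _ n]; simp)
  then have "lower_left n (?p * g * ?p') = P' * c * Q' + P' * d * 0\<^sub>m n n"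
    using PQ P' Q' blocks by (simp only:) (intro lower_left_four_block; simp)
  also have "\<dots> = P' * c * Q'" using PQ P' Q' blocks by simp
  also have "P' * c * Q' = P' * (P * unit_block n n r * Q) * Q'"
    unfolding PQ(6) ..
  also have "\<dots> = (P' * P) * unit_block n n r * (Q * Q')"
    using PQ P' Q' by (intro mult_mat_regroup) auto
  also have "\<dots> = unit_block n n r" using P' Q' by simp
  finally have "lower_left n (?p * g * ?p') = unit_block n n r" .
  moreover have "?p \<in> siegel_parabolic n" "?p' \<in> siegel_parabolic n"
    using PQ P' Q' by (auto intro!: siegel_parabolicI simp: mult.commute)
  ultimately show ?thesis using that PQ(5) by blast
qed

text \<open>
  In \<open>reduce_lower_right\<close> the determinant of \<open>Q\<close> is compensated on a coordinate that the upper left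
  unit block of size \<open>r\<close> does not see. There is none if \<open>r = n\<close>, when the matrix to be reduced has no
  rows and \<open>Q\<close> can be the unit matrix.
\<close>

lemma rank_normal_form_unimodular_if_no_rows:
  fixes X :: "'a::field mat"
  assumes X: "X \<in> carrier_mat k n"
  obtains P Q s where "P \<in> carrier_mat k k" "det P \<noteq> 0" "Q \<in> carrier_mat n n" "det Q \<noteq> 0"
    "s \<le> k" "X = P * unit_block k n s * Q" "k = 0 \<longrightarrow> det Q = 1"
proof (cases "k = 0")
  case True
  then have "X = 1\<^sub>m k * unit_block k n 0 * 1\<^sub>m n" using X by (intro eq_matI) auto
  then show ?thesis using that[of "1\<^sub>m k" "1\<^sub>m n" 0] by simp
next
  case False
  then show ?thesis using rank_normal_form[OF X] that by blast
qed

lemma SL_last_row_nonzero: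
  assumes M: "M \<in> SL m" and m: "m \<ge> 1"
  shows "\<exists>j<m. M $$ (m - 1, j) \<noteq> (0 :: 'a::field)"
proof (rule ccontr)
  assume no: "\<not> ?thesis"
  obtain W where W: "W \<in> SL m" "M * W = 1\<^sub>m m" using M by (rule SL_inverse)
  have "row M (m - 1) = 0\<^sub>v m"
    using no m SL_carrier[OF M] by (intro eq_vecI) auto
  moreover have "0\<^sub>v m \<bullet> col W (m - 1) = 0"
    using col_dim[of W "m - 1"] SL_carrier[OF W(1)] by (intro scalar_prod_left_zero) simp
  ultimately have "(M * W) $$ (m - 1, m - 1) = 0"
    using SL_carrier[OF M] SL_carrier[OF W(1)] m by simp
  then show False using W(2) m by simp
qed

text \<open>
  The lower blocks of \<open>h\<close> are \<open>E = unit_block n n r\<close> and \<open>d\<close>. Adding multiples of \<open>E\<close> to the columns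
  of \<open>d\<close> clears its first \<open>r\<close> rows. The remaining \<open>n - r\<close> rows of \<open>d\<close> are brought into normal form by
  row operations that fix \<open>E\<close>, and by column operations. Their rank is \<open>n - r\<close>, as \<open>h\<close> would
  otherwise be equivalent to a matrix with a zero row.
\<close>

lemma reduce_lower_right:
  fixes h :: "'a::field mat"
  assumes h: "h \<in> SL (2 * n)" and r: "r \<le> n" and low: "lower_left n h = unit_block n n r" and n: "n \<ge> 1"
  obtains p p' a b where "p \<in> siegel_parabolic n" "p' \<in> siegel_parabolic n"
    "a \<in> carrier_mat n n" "b \<in> carrier_mat n n"
    "p * h * p' = four_block_mat a b (unit_block n n r) (standard_lower_right n r)"
proof -
  let ?E = "unit_block n n r :: 'a mat"
  define k where "k = n - r"
  have nk: "n = r + k" using r by (simp add: k_def)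
  obtain a b c d where blocks: "a \<in> carrier_mat n n" "b \<in> carrier_mat n n" "c \<in> carrier_mat n n" "d \<in> carrier_mat n n"
    "h = four_block_mat a b c d" "lower_left n h = c"
    using SL_carrier[OF h] by (rule square_blocks)
  have c: "c = ?E" using blocks(6) low by simp
  have X: "drop_rows r d \<in> carrier_mat k n" using blocks(4) by (auto simp: drop_rows_def k_def)
  obtain P Q s where PQ: "P \<in> carrier_mat k k" "det P \<noteq> 0" "Q \<in> carrier_mat n n" "det Q \<noteq> 0"
    "s \<le> k" "drop_rows r d = P * unit_block k n s * Q" and Q1: "k = 0 \<longrightarrow> det Q = 1"
    using X by (rule rank_normal_form_unimodular_if_no_rows)
  obtain P' where P': "P' \<in> carrier_mat k k" "P * P' = 1\<^sub>m k" "P' * P = 1\<^sub>m k" "det P * det P' = 1"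
    using inverse_if_det_nonzero[OF PQ(1,2)] by blast
  obtain Q' where Q': "Q' \<in> carrier_mat n n" "Q * Q' = 1\<^sub>m n" "Q' * Q = 1\<^sub>m n" "det Q * det Q' = 1"
    using inverse_if_det_nonzero[OF PQ(3,4)] by blast
  define diag where "diag = (\<lambda>W :: 'a mat. four_block_mat (1\<^sub>m r) (0\<^sub>m r k) (0\<^sub>m k r) W)"
  have diag: "diag W \<in> carrier_mat n n" "det (diag W) = det W" if "W \<in> carrier_mat k k" for W
    using that nk det_four_block_mat_upper_right_zero[of "1\<^sub>m r" r "0\<^sub>m r k" k "0\<^sub>m k r" W]
    by (auto simp: diag_def)
  \<comment> \<open>The last coordinate absorbs \<open>det Q\<close>, so that the right factor below has determinant one.\<close>
  let ?\<Delta> = "multrow_mat n (n - 1) (det Q)"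
  have E\<Delta>: "?E * ?\<Delta> = ?E"
  proof (rule eq_matI)
    fix i j assume "i < dim_row ?E" "j < dim_col ?E"
    then have ij: "i < n" "j < n" by auto
    have "(?E * ?\<Delta>) $$ (i, j) = (if i < r then ?\<Delta> $$ (i, j) else 0)"
      using ij r by (intro index_unit_block_mult[of _ n]) auto
    also have "\<dots> = ?E $$ (i, j)"
    proof (cases "i = n - 1 \<and> i < r")
      case True
      then have "det Q = 1" using r n Q1 by (auto simp: k_def)
      then show ?thesis using ij by (auto simp: unit_block_def)
    qed (use ij in \<open>auto simp: unit_block_def\<close>)
    finally show "(?E * ?\<Delta>) $$ (i, j) = ?E $$ (i, j)" .
  qed auto
  have LE: "diag P' * ?E = ?E"
  proof (rule eq_matI)
    fix i j assume "i < dim_row ?E" "j < dim_col ?E"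
    then have ij: "i < n" "j < n" by auto
    have "(diag P' * ?E) $$ (i, j) = (if j < r then diag P' $$ (i, j) else 0)"
      using ij r by (intro index_mult_unit_block[OF diag(1)[OF P'(1)]]) auto
    also have "\<dots> = ?E $$ (i, j)" using ij nk P'(1) by (auto simp: unit_block_def diag_def)
    finally show "(diag P' * ?E) $$ (i, j) = ?E $$ (i, j)" .
  qed (use diag[OF P'(1)] in auto)
  let ?p = "four_block_mat (diag P) (0\<^sub>m n n) (0\<^sub>m n n) (diag P')"
  let ?p' = "four_block_mat ?\<Delta> (- (d * Q')) (0\<^sub>m n n) Q'"
  have p: "?p \<in> siegel_parabolic n" using diag PQ P' by (intro siegel_parabolicI) auto
  have p': "?p' \<in> siegel_parabolic n"
    using blocks Q' n by (intro siegel_parabolicI) (auto simp: det_multrow_mat)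
  note D = diag(1)[OF PQ(1)] diag(1)[OF P'(1)]
  have "?p * h = four_block_mat (diag P * a + 0\<^sub>m n n * c) (diag P * b + 0\<^sub>m n n * d)
      (0\<^sub>m n n * a + diag P' * c) (0\<^sub>m n n * b + diag P' * d)"
    unfolding blocks(5) using D blocks by (intro mult_four_block_mat[of _ n n _ n _ n _ _ n _ n]) auto
  also have "\<dots> = four_block_mat (diag P * a) (diag P * b) ?E (diag P' * d)"
    using D blocks LE unfolding c by simp
  finally have "?p * h * ?p' = four_block_mat (diag P * a * ?\<Delta> + diag P * b * 0\<^sub>m n n)
     (diag P * a * (- (d * Q')) + diag P * b * Q')
     (?E * ?\<Delta> + diag P' * d * 0\<^sub>m n n) (?E * (- (d * Q')) + diag P' * d * Q')"
    using D blocks Q' by (simp only:) (intro mult_four_block_mat[of _ n n _ n _ n _ _ n _ n]; simp)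
  also have "?E * ?\<Delta> + diag P' * d * 0\<^sub>m n n = ?E"
    using D blocks unfolding E\<Delta> by simp
  finally obtain a1 b1 Z where prod: "?p * h * ?p' = four_block_mat a1 b1 ?E Z"
    and a1: "a1 = diag P * a * ?\<Delta> + diag P * b * 0\<^sub>m n n"
    and b1: "b1 = diag P * a * (- (d * Q')) + diag P * b * Q'"
    and Z_def: "Z = ?E * (- (d * Q')) + diag P' * d * Q'" by blast
  have ab: "a1 \<in> carrier_mat n n" "b1 \<in> carrier_mat n n" "Z \<in> carrier_mat n n"
    unfolding a1 b1 Z_def using D blocks Q' by simp_all
  have Z: "Z $$ (i, j) = (if r \<le> i \<and> j = i - r \<and> i - r < s then 1 else 0)" if ij: "i < n" "j < n" for i j
  proof -
    have Y: "d * Q' \<in> carrier_mat n n" using blocks Q' by simp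
    have "drop_rows r (d * Q') = P * unit_block k n s * Q * Q'"
      using blocks Q' r by (subst drop_rows_mult) (auto simp: PQ(6)[symmetric])
    then have "P' * drop_rows r (d * Q') = P' * (P * unit_block k n s * Q * Q')" by simp
    also have "\<dots> = P' * (P * unit_block k n s * Q) * Q'"
      using PQ P' Q' by (intro assoc_mult_mat[of _ k k _ n _ n, symmetric]) auto
    also have "\<dots> = (P' * P) * unit_block k n s * (Q * Q')"
      using PQ P' Q' by (intro mult_mat_regroup) auto
    also have "\<dots> = unit_block k n s" using P' Q' by simp
    finally have XY: "P' * drop_rows r (d * Q') = unit_block k n s" .
    have "diag P' * d * Q' = diag P' * (d * Q')"
      using D blocks Q' by (intro assoc_mult_mat[of _ n n _ n _ n]) auto
    then have "(diag P' * d * Q') $$ (i, j) = (if i < r then (d * Q') $$ (i, j) else unit_block k n s $$ (i - r, j))"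
      using block_diag_one_mult[OF P'(1), of "d * Q'" r n i j] ij Y XY nk unfolding diag_def by simp
    moreover have "(?E * (- (d * Q'))) $$ (i, j) = (if i < r then (- (d * Q')) $$ (i, j) else 0)"
      using ij Y r by (intro index_unit_block_mult[of _ n]) auto
    moreover have "Z $$ (i, j) = (?E * (- (d * Q'))) $$ (i, j) + (diag P' * d * Q') $$ (i, j)"
      unfolding Z_def using ij D blocks Q' by (intro index_add_mat) simp_all
    moreover have "(- (d * Q')) $$ (i, j) = - ((d * Q') $$ (i, j))"
      using ij Y by (intro index_uminus_mat) auto
    ultimately show ?thesis using ij nk by (auto simp: unit_block_def)
  qed
  have "s = k"
  proof (rule ccontr)
    assume "s \<noteq> k"
    then have sk: "s < k" using PQ(5) by simp
    have "four_block_mat a1 b1 ?E Z \<in> SL (2 * n)"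
      unfolding prod[symmetric] by (intro SL_mult h siegel_parabolic_SL p p')
    then obtain j where j: "j < 2 * n" "four_block_mat a1 b1 ?E Z $$ (2 * n - 1, j) \<noteq> 0"
      using SL_last_row_nonzero[of "four_block_mat a1 b1 ?E Z" "2 * n"] n by auto
    have "2 * n - 1 - n = n - 1" "\<not> 2 * n - 1 < n" using n by auto
    then have "four_block_mat a1 b1 ?E Z $$ (2 * n - 1, j) = (if j < n then ?E $$ (n - 1, j) else Z $$ (n - 1, j - n))"
      using j(1) n carrier_matD[OF ab(1)] carrier_matD[OF ab(3)] by (subst index_mat_four_block) auto
    also have "\<dots> = 0"
      using j(1) sk nk n Z[of "n - 1" "j - n"] by (auto simp: unit_block_def)
    finally show False using j(2) by simp
  qed
  have "Z = standard_lower_right n r"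
  proof (rule eq_matI)
    fix i j assume "i < dim_row (standard_lower_right n r :: 'a mat)" "j < dim_col (standard_lower_right n r :: 'a mat)"
    then have ij: "i < n" "j < n" by (auto simp: standard_lower_right_def)
    then show "Z $$ (i, j) = standard_lower_right n r $$ (i, j)"
      using \<open>s = k\<close> nk unfolding Z[OF ij] by (auto simp: standard_lower_right_def)
  qed (use ab in \<open>auto simp: standard_lower_right_def\<close>)
  then show ?thesis using that[OF p p' ab(1,2)] prod by simp
qed

section \<open>Invariant vectors as functions of the rank\<close>

definition cell_indicator :: "nat \<Rightarrow> nat \<Rightarrow> 'a::{field, finite} mat \<Rightarrow> complex" where
  "cell_indicator n j g =
    (if g \<in> SL (2 * n) \<and> card (mat_range (lower_left n g)) = card (UNIV :: 'a set) ^ j then 1 else 0)"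

lemma Ind_inv_left_right:
  assumes f: "f \<in> Ind_inv n" and p: "p \<in> siegel_parabolic n" and g: "g \<in> SL (2 * n)" and p': "p' \<in> siegel_parabolic n"
  shows "f (p * g * p') = f g"
proof -
  have pc: "p * g * p' = p * (g * p')"
    using SL_carrier siegel_parabolic_SL p p' g by (metis assoc_mult_mat)
  have "g * p' \<in> SL (2 * n)" using g siegel_parabolic_SL[OF p'] by (rule SL_mult)
  then have "f (p * (g * p')) = f (g * p')" using f p by (simp add: Ind_inv_def Ind_def)
  also have "\<dots> = right_translation n p' f g" using g by (simp add: right_translation_def)
  also have "\<dots> = f g" using f p' by (simp add: Ind_inv_def)
  finally show ?thesis unfolding pc .
qed

lemma SL_rank:
  fixes g :: "'a::{field, finite} mat"
  assumes g: "g \<in> SL (2 * n)"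
  obtains r where "r \<le> n" "card (mat_range (lower_left n g)) = card (UNIV :: 'a set) ^ r"
proof -
  obtain p p' r where pp: "p \<in> siegel_parabolic n" "p' \<in> siegel_parabolic n" "r \<le> n"
    "lower_left n (p * g * p') = unit_block n n r"
    using g by (rule reduce_lower_left)
  then have "card (mat_range (lower_left n g)) = card (UNIV :: 'a set) ^ r"
    using card_mat_range_lower_left[OF pp(1) g pp(2)] card_mat_range_unit_block[of r n, where 'a = 'a] by simp
  with pp(3) show ?thesis using that by blast
qed

text \<open>
  The rank of \<open>c\<close> is preserved by \<open>reduce_lower_left\<close>, so the resulting lower blocks depend on nothing
  but the rank of \<open>c\<close>.
\<close>

lemma bruhat_normal_form:
  fixes g :: "'a::{field, finite} mat"
  assumes g: "g \<in> SL (2 * n)" and n: "n \<ge> 1" and rank: "card (mat_range (lower_left n g)) = card (UNIV :: 'a set) ^ r"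
  obtains p p' a b where "p \<in> siegel_parabolic n" "p' \<in> siegel_parabolic n"
    "a \<in> carrier_mat n n" "b \<in> carrier_mat n n"
    "p * g * p' = four_block_mat a b (unit_block n n r) (standard_lower_right n r)"
proof -
  obtain p1 p1' s where p1: "p1 \<in> siegel_parabolic n" "p1' \<in> siegel_parabolic n" "s \<le> n"
    "lower_left n (p1 * g * p1') = unit_block n n s"
    using g by (rule reduce_lower_left)
  have "card (UNIV :: 'a set) ^ r = card (mat_range (lower_left n (p1 * g * p1')))"
    unfolding card_mat_range_lower_left[OF p1(1) g p1(2)] rank ..
  also have "\<dots> = card (UNIV :: 'a set) ^ s"
    unfolding p1(4) using p1(3) by (rule card_mat_range_unit_block)
  finally have s: "s = r" unfolding power_card_UNIV_inject ..
  note SL = siegel_parabolic_SL[OF p1(1)] siegel_parabolic_SL[OF p1(2)]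
  have g1: "p1 * g * p1' \<in> SL (2 * n)" using SL g by (intro SL_mult)
  obtain p2 p2' a b where p2: "p2 \<in> siegel_parabolic n" "p2' \<in> siegel_parabolic n"
    "a \<in> carrier_mat n n" "b \<in> carrier_mat n n"
    "p2 * (p1 * g * p1') * p2' = four_block_mat a b (unit_block n n s) (standard_lower_right n s)"
    using g1 p1(3,4) n by (rule reduce_lower_right)
  have "p2 * (p1 * g * p1') * p2' = (p2 * p1) * g * (p1' * p2')"
    using SL_carrier[OF SL(1)] SL_carrier[OF SL(2)] SL_carrier[OF g]
      SL_carrier[OF siegel_parabolic_SL[OF p2(1)]] SL_carrier[OF siegel_parabolic_SL[OF p2(2)]]
    by (intro mult_mat_regroup[of _ "2 * n" _ _ "2 * n"])
  then have "(p2 * p1) * g * (p1' * p2') = four_block_mat a b (unit_block n n r) (standard_lower_right n r)"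
    using p2(5) unfolding s by simp
  then show ?thesis
    by (rule that[OF siegel_parabolic_mult[OF p2(1) p1(1)] siegel_parabolic_mult[OF p1(2) p2(2)] p2(3,4)])
qed

text \<open>
  Elements of the same rank share their normal form up to the upper blocks, which are adjusted by one
  more left factor from the parabolic.
\<close>

lemma Ind_inv_eq_if_same_rank:
  fixes g g' :: "'a::{field, finite} mat"
  assumes f: "f \<in> Ind_inv n" and n: "n \<ge> 1" and g: "g \<in> SL (2 * n)" and g': "g' \<in> SL (2 * n)"
    and eq: "card (mat_range (lower_left n g)) = card (mat_range (lower_left n g'))"
  shows "f g = f g'"
proof -
  obtain r where r: "card (mat_range (lower_left n g)) = card (UNIV :: 'a set) ^ r"
    using g by (rule SL_rank)
  obtain p p' a b where p: "p \<in> siegel_parabolic n" "p' \<in> siegel_parabolic n"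
    "a \<in> carrier_mat n n" "b \<in> carrier_mat n n"
    "p * g * p' = four_block_mat a b (unit_block n n r) (standard_lower_right n r)"
    using g n r by (rule bruhat_normal_form)
  obtain s s' a' b' where s: "s \<in> siegel_parabolic n" "s' \<in> siegel_parabolic n"
    "a' \<in> carrier_mat n n" "b' \<in> carrier_mat n n"
    "s * g' * s' = four_block_mat a' b' (unit_block n n r) (standard_lower_right n r)"
    using g' n r[unfolded eq] by (rule bruhat_normal_form)
  have SL: "p * g * p' \<in> SL (2 * n)" by (intro SL_mult siegel_parabolic_SL g p(1,2))
  have SL': "s * g' * s' \<in> SL (2 * n)" by (intro SL_mult siegel_parabolic_SL g' s(1,2))
  obtain t where t: "t \<in> siegel_parabolic n" "s * g' * s' = t * (p * g * p')"
    using same_lower_rows_same_coset[OF p(3,4) unit_block_carrier standard_lower_right_carrier s(3,4)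
      SL[unfolded p(5)] SL'[unfolded s(5)]] unfolding p(5) s(5) by blast
  have "f g = f (p * g * p')" using f p(1) g p(2) by (rule Ind_inv_left_right[symmetric])
  also have "\<dots> = f (s * g' * s')" using f t SL by (simp add: Ind_inv_def Ind_def)
  also have "\<dots> = f g'" using f s(1) g' s(2) by (rule Ind_inv_left_right)
  finally show ?thesis .
qed

lemma cell_indicator_Ind_inv: "cell_indicator n j \<in> Ind_inv n"
proof -
  have left: "cell_indicator n j (p * g) = cell_indicator n j g"
    if p: "p \<in> siegel_parabolic n" and g: "g \<in> SL (2 * n)" for p g :: "'a mat"
  proof -
    have pg: "p * g \<in> SL (2 * n)" using siegel_parabolic_SL[OF p] g by (rule SL_mult)
    then have "p * g * 1\<^sub>m (2 * n) = p * g" using right_mult_one_mat[OF SL_carrier] by blast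
    then show ?thesis
      using card_mat_range_lower_left[OF p g one_siegel_parabolic] pg g by (simp add: cell_indicator_def)
  qed
  have right: "cell_indicator n j (g * p) = cell_indicator n j g"
    if p: "p \<in> siegel_parabolic n" and g: "g \<in> SL (2 * n)" for p g :: "'a mat"
  proof -
    have "g * p \<in> SL (2 * n)" using g siegel_parabolic_SL[OF p] by (rule SL_mult)
    moreover have "1\<^sub>m (2 * n) * g = g" using left_mult_one_mat[OF SL_carrier[OF g]] .
    ultimately show ?thesis
      using card_mat_range_lower_left[OF one_siegel_parabolic g p] g by (simp add: cell_indicator_def)
  qed
  have "right_translation n p (cell_indicator n j) = cell_indicator n j"
    if "p \<in> siegel_parabolic n" for p :: "'a mat"
    using right[OF that] by (auto simp: right_translation_def fun_eq_iff cell_indicator_def)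
  with left show ?thesis
    by (auto simp: Ind_inv_def Ind_def) (simp add: cell_indicator_def)
qed

lemma cell_representative:
  fixes n r :: nat
  assumes "r \<le> n"
  defines "w \<equiv> four_block_mat (1\<^sub>m n) (0\<^sub>m n n) (unit_block n n r) (1\<^sub>m n) :: 'a::{field, finite} mat"
  shows "w \<in> SL (2 * n)" and "card (mat_range (lower_left n w)) = card (UNIV :: 'a set) ^ r"
proof -
  have "det w = 1" unfolding w_def
    by (subst det_four_block_mat_upper_right_zero[of _ n _ n]) auto
  then show "w \<in> SL (2 * n)" by (simp add: SL_def w_def mult_2)
  have "lower_left n w = unit_block n n r" unfolding w_def by (rule lower_left_four_block) auto
  then show "card (mat_range (lower_left n w)) = card (UNIV :: 'a set) ^ r"
    using card_mat_range_unit_block[OF assms(1), where 'a = 'a] by simp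
qed

lemma cfun_sum_apply: "(\<Sum>i\<in>I. F i) x = (\<Sum>i\<in>I. F i x :: complex)"
  by (induction I rule: infinite_finite_induct) auto

lemma Ind_inv_iff:
  "f \<in> Ind_inv n \<longleftrightarrow> (\<forall>g. g \<notin> SL (2 * n) \<longrightarrow> f g = 0) \<and>
    (\<forall>p\<in>siegel_parabolic n. \<forall>g\<in>SL (2 * n). f (p * g) = f g \<and> f (g * p) = f g)"
  by (auto simp: Ind_inv_def Ind_def right_translation_def fun_eq_iff split: if_splits)

lemma Ind_inv_subspace: "cfun.subspace (Ind_inv n)"
  by (rule cfun.subspaceI) (auto simp: Ind_inv_iff)

text \<open>
  The coordinate of \<open>f\<close> at the indicator of rank \<open>r\<close> is the value of \<open>f\<close> at the representative
  \<open>w r\<close> of that rank, which also shows independence.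
\<close>

lemma ordered_basis_cell_indicator:
  assumes n: "n \<ge> 1"
  shows "ordered_basis (n + 1) (cell_indicator n :: nat \<Rightarrow> 'a::{field, finite} mat \<Rightarrow> complex) (Ind_inv n)"
proof -
  let ?b = "cell_indicator n :: nat \<Rightarrow> 'a mat \<Rightarrow> complex"
  define w where "w = (\<lambda>r. four_block_mat (1\<^sub>m n) (0\<^sub>m n n) (unit_block n n r) (1\<^sub>m n) :: 'a mat)"
  have w: "w r \<in> SL (2 * n)" "card (mat_range (lower_left n (w r))) = card (UNIV :: 'a set) ^ r" if "r \<le> n" for r
    unfolding w_def using cell_representative[OF that] by auto
  have bw: "?b i (w r) = (if i = r then 1 else 0)" if "r \<le> n" for i r
    using w(1)[OF that] unfolding cell_indicator_def w(2)[OF that] power_card_UNIV_inject by simp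
  have inj: "inj_on ?b {..<n + 1}"
  proof (rule inj_onI)
    fix i j assume "i \<in> {..<n + 1}" "j \<in> {..<n + 1}" and eq: "?b i = ?b j"
    then have "i \<le> n" by simp
    from bw[OF this, of i] bw[OF this, of j] show "i = j" unfolding eq by (simp split: if_splits)
  qed
  have indep: "cfun.independent (?b ` {..<n + 1})"
  proof
    assume "cfun.dependent (?b ` {..<n + 1})"
    then obtain u v where v: "v \<in> ?b ` {..<n + 1}" "u v \<noteq> 0"
      and 0: "(\<Sum>v\<in>?b ` {..<n + 1}. (\<lambda>x. u v * v x)) = 0"
      unfolding cfun.dependent_finite[OF finite_imageI[OF finite_lessThan]] by blast
    from v(1) obtain r where "r < n + 1" and v_r: "v = ?b r" by blast
    then have r: "r \<le> n" "v = ?b r" by simp_all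
    have "(\<Sum>v\<in>?b ` {..<n + 1}. (\<lambda>x. u v * v x)) (w r) = (\<Sum>i<n + 1. u (?b i) * ?b i (w r))"
      unfolding cfun_sum_apply by (subst sum.reindex[OF inj]) simp
    also have "\<dots> = (\<Sum>i<n + 1. if i = r then u (?b i) else 0)"
      using r by (intro sum.cong) (auto simp: bw)
    also have "\<dots> = u v" using r by simp
    finally show False using v(2) unfolding 0 by simp
  qed
  have "cfun.span (?b ` {..<n + 1}) = Ind_inv n"
  proof
    show "cfun.span (?b ` {..<n + 1}) \<subseteq> Ind_inv n"
      using cell_indicator_Ind_inv by (intro cfun.span_minimal Ind_inv_subspace) auto
    show "Ind_inv n \<subseteq> cfun.span (?b ` {..<n + 1})"
    proof
      fix f :: "'a mat \<Rightarrow> complex" assume f: "f \<in> Ind_inv n"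
      have "f = (\<Sum>i<n + 1. (\<lambda>x. f (w i) * ?b i x))"
      proof
        fix g
        have "(\<Sum>i<n + 1. (\<lambda>x. f (w i) * ?b i x)) g = (\<Sum>i<n + 1. f (w i) * ?b i g)"
          by (rule cfun_sum_apply)
        also have "\<dots> = f g"
        proof (cases "g \<in> SL (2 * n)")
          case True
          then obtain r where r: "r \<le> n" "card (mat_range (lower_left n g)) = card (UNIV :: 'a set) ^ r"
            by (rule SL_rank)
          have "(\<Sum>i<n + 1. f (w i) * ?b i g) = (\<Sum>i<n + 1. if i = r then f (w i) else 0)"
            using True unfolding cell_indicator_def r(2) power_card_UNIV_inject
            by (intro sum.cong) auto
          also have "\<dots> = f (w r)" using r by simp
          also have "\<dots> = f g"
            using f n w(1)[OF r(1)] True w(2)[OF r(1)] r(2) by (intro Ind_inv_eq_if_same_rank) auto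
          finally show ?thesis .
        next
          case False
          then show ?thesis using f by (simp add: cell_indicator_def Ind_inv_def Ind_def)
        qed
        finally show "f g = (\<Sum>i<n + 1. (\<lambda>x. f (w i) * ?b i x)) g" ..
      qed
      moreover have "(\<Sum>i<n + 1. (\<lambda>x. f (w i) * ?b i x)) \<in> cfun.span (?b ` {..<n + 1})"
        by (intro cfun.span_sum cfun.span_scale cfun.span_base imageI)
      ultimately show "f \<in> cfun.span (?b ` {..<n + 1})" by simp
    qed
  qed
  with inj indep show ?thesis by (simp add: ordered_basis_def)
qed

section \<open>The intertwining operator on rank indicators\<close>

lemma weyl_element_SL:
  "four_block_mat (0\<^sub>m n n) (1\<^sub>m n) (- 1\<^sub>m n) (0\<^sub>m n n) \<in> (SL (2 * n) :: 'a::field mat set)"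
proof -
  have "det (four_block_mat (0\<^sub>m n n) (1\<^sub>m n) (- 1\<^sub>m n) (0\<^sub>m n n) :: 'a mat) = det (0\<^sub>m n n * 0\<^sub>m n n - 1\<^sub>m n * - 1\<^sub>m n :: 'a mat)"
  proof (rule det_four_block_mat[of _ n])
    show "- 1\<^sub>m n * 0\<^sub>m n n = 0\<^sub>m n n * (- 1\<^sub>m n :: 'a mat)" by (intro eq_matI) auto
  qed simp_all
  also have "0\<^sub>m n n * 0\<^sub>m n n - 1\<^sub>m n * - 1\<^sub>m n = (1\<^sub>m n :: 'a mat)"
    by (intro eq_matI) auto
  finally show ?thesis by (simp add: SL_def mult_2)
qed

text \<open>
  The lower left block of the translate by \<open>B\<close> is \<open>- (a + B * c)\<close>, so the sum counts the matrices \<open>B\<close>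
  for which \<open>a + B * c\<close> has rank \<open>j\<close>. The blocks \<open>a\<close> and \<open>c\<close> have no common kernel because \<open>g\<close> is
  invertible.
\<close>

lemma intertwiner_cell_indicator:
  fixes g :: "'a::{field, finite} mat"
  defines "q \<equiv> card (UNIV :: 'a set)"
  assumes g: "g \<in> SL (2 * n)" and rank: "card (mat_range (lower_left n g)) = q ^ r" and r: "r \<le> n" and j: "j \<le> n"
  shows "intertwiner n (cell_indicator n j) g = M_matrix n (of_nat q) $$ (r, j)"
proof -
  obtain a b c d where blocks: "a \<in> carrier_mat n n" "b \<in> carrier_mat n n" "c \<in> carrier_mat n n" "d \<in> carrier_mat n n"
    "g = four_block_mat a b c d" "lower_left n g = c"
    using SL_carrier[OF g] by (rule square_blocks)
  let ?w = "four_block_mat (0\<^sub>m n n) (1\<^sub>m n) (- 1\<^sub>m n) (0\<^sub>m n n) :: 'a mat"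
  let ?u = "\<lambda>B. four_block_mat (1\<^sub>m n) B (0\<^sub>m n n) (1\<^sub>m n) :: 'a mat"
  have ind: "cell_indicator n j (?w * ?u B * g) = (if card (mat_range (a + B * c)) = q ^ j then 1 else 0)"
    if B: "B \<in> carrier_mat n n" for B
  proof -
    have "?u B \<in> siegel_parabolic n" using B by (intro siegel_parabolicI) simp_all
    then have SL: "?w * ?u B * g \<in> SL (2 * n)"
      by (intro SL_mult weyl_element_SL siegel_parabolic_SL g)
    have "?w * ?u B = four_block_mat (0\<^sub>m n n * 1\<^sub>m n + 1\<^sub>m n * 0\<^sub>m n n) (0\<^sub>m n n * B + 1\<^sub>m n * 1\<^sub>m n)
        (- 1\<^sub>m n * 1\<^sub>m n + 0\<^sub>m n n * 0\<^sub>m n n) (- 1\<^sub>m n * B + 0\<^sub>m n n * 1\<^sub>m n)"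
      using B by (intro mult_four_block_mat[of _ n n _ n _ n _ _ n _ n]) simp_all
    also have "\<dots> = four_block_mat (0\<^sub>m n n) (1\<^sub>m n) (- 1\<^sub>m n) (- B)"
      using B by simp
    finally have "?w * ?u B * g = four_block_mat (0\<^sub>m n n * a + 1\<^sub>m n * c) (0\<^sub>m n n * b + 1\<^sub>m n * d)
        (- 1\<^sub>m n * a + - B * c) (- 1\<^sub>m n * b + - B * d)"
      unfolding blocks(5) using B blocks by (simp only:) (intro mult_four_block_mat[of _ n n _ n _ n _ _ n _ n]; simp)
    then have "lower_left n (?w * ?u B * g) = - 1\<^sub>m n * a + - B * c"
      using B blocks by (simp only:) (intro lower_left_four_block; simp)
    also have "\<dots> = - 1\<^sub>m n * (a + B * c)"
      using B blocks by (intro eq_matI) auto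
    finally have ll: "lower_left n (?w * ?u B * g) = - 1\<^sub>m n * (a + B * c)" .
    have "det (- 1\<^sub>m n :: 'a mat) \<noteq> 0"
    proof
      assume "det (- 1\<^sub>m n :: 'a mat) = 0"
      moreover have "det (- 1\<^sub>m n * - 1\<^sub>m n :: 'a mat) = det (- 1\<^sub>m n :: 'a mat) * det (- 1\<^sub>m n :: 'a mat)"
        by (rule det_mult[of _ n]) simp_all
      moreover have "- 1\<^sub>m n * - 1\<^sub>m n = (1\<^sub>m n :: 'a mat)" by (intro eq_matI) auto
      ultimately show False by simp
    qed
    then have "card (mat_range (- 1\<^sub>m n * (a + B * c))) = card (mat_range (a + B * c))"
      using B blocks by (intro card_mat_range_mult_left[of _ n n]) simp_all
    then show ?thesis using SL by (simp add: cell_indicator_def ll q_def)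
  qed
  have "intertwiner n (cell_indicator n j) g = (\<Sum>B\<in>carrier_mat n n. if card (mat_range (a + B * c)) = q ^ j then 1 else 0)"
    unfolding intertwiner_def if_P[OF g] by (rule sum.cong[OF refl ind])
  also have "\<dots> = of_nat (card {B \<in> carrier_mat n n. card (mat_range (a + B * c)) = q ^ j})"
    by (simp add: finite_carrier_mat sum.If_cases Int_def)
  also have "\<dots> = (if n \<le> r + j then of_nat q ^ (n\<^sup>2 - r\<^sup>2) *
      (gauss_binomial (of_nat q) r (r + j - n) * q_falling (of_nat q) (r + j - n) (of_nat q ^ r)) else 0)"
    unfolding q_def
  proof (rule card_rank_add_mult[OF blocks(1,3) _ rank[unfolded q_def blocks(6)] r])
    fix x :: "'a vec"
    assume x: "x \<in> carrier_vec n" "a *\<^sub>v x = 0\<^sub>v n" "c *\<^sub>v x = 0\<^sub>v n"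
    obtain h where h: "h \<in> SL (2 * n)" "h * g = 1\<^sub>m (2 * n)" using g by (rule SL_inverse)
    let ?x = "x @\<^sub>v 0\<^sub>v n"
    have xc: "?x \<in> carrier_vec (2 * n)" using x(1) by (simp add: mult_2)
    have "g *\<^sub>v ?x = (a *\<^sub>v x + b *\<^sub>v 0\<^sub>v n) @\<^sub>v (c *\<^sub>v x + d *\<^sub>v 0\<^sub>v n)"
      unfolding blocks(5) using blocks x by (intro four_block_mat_mult_vec[of _ n n _ n _ n]) simp_all
    also have "\<dots> = 0\<^sub>v (2 * n)"
      using x blocks by (intro eq_vecI) (auto simp: scalar_prod_def)
    finally have "h *\<^sub>v (g *\<^sub>v ?x) = h *\<^sub>v 0\<^sub>v (2 * n)" by simp
    also have "\<dots> = 0\<^sub>v (2 * n)"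
      using SL_carrier[OF h(1)] by (intro eq_vecI) (auto simp: scalar_prod_def)
    finally have "?x = 0\<^sub>v (2 * n)"
      using assoc_mult_mat_vec[OF SL_carrier[OF h(1)] SL_carrier[OF g] xc] h(2) xc by simp
    then show "x = 0\<^sub>v n"
    proof (intro eq_vecI)
      fix i assume "i < dim_vec (0\<^sub>v n :: 'a vec)"
      then show "x $ i = 0\<^sub>v n $ i"
        using arg_cong[OF \<open>?x = 0\<^sub>v (2 * n)\<close>, of "\<lambda>v. v $ i"] x(1) by simp
    qed (use x in simp)
  qed
  also have "\<dots> = M_matrix n (of_nat q) $$ (r, j)"
    using card_UNIV_field_ge_2[where 'a = 'a] r j
    by (subst M_matrix_entry) (auto simp: q_def of_nat_power_neq_1)
  finally show ?thesis .
qed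

lemma has_matrix_cell_indicator:
  "has_matrix (intertwiner n) (n + 1) (cell_indicator n :: nat \<Rightarrow> 'a::{field, finite} mat \<Rightarrow> complex)
    (M_matrix n (of_nat (card (UNIV :: 'a set))))"
proof -
  let ?b = "cell_indicator n :: nat \<Rightarrow> 'a mat \<Rightarrow> complex" and ?M = "M_matrix n (of_nat (card (UNIV :: 'a set)))"
  have "intertwiner n (?b j) = (\<lambda>g. \<Sum>i<n + 1. ?M $$ (i, j) * ?b i g)" if j: "j < n + 1" for j
  proof
    fix g :: "'a mat"
    show "intertwiner n (?b j) g = (\<Sum>i<n + 1. ?M $$ (i, j) * ?b i g)"
    proof (cases "g \<in> SL (2 * n)")
      case True
      then obtain r where r: "r \<le> n" "card (mat_range (lower_left n g)) = card (UNIV :: 'a set) ^ r"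
        by (rule SL_rank)
      have "(\<Sum>i<n + 1. ?M $$ (i, j) * ?b i g) = (\<Sum>i<n + 1. if i = r then ?M $$ (i, j) else 0)"
        using True unfolding cell_indicator_def r(2) power_card_UNIV_inject by (intro sum.cong) auto
      also have "\<dots> = ?M $$ (r, j)" using r(1) by simp
      also have "\<dots> = intertwiner n (?b j) g"
        using intertwiner_cell_indicator[OF True r(2,1), of j] j by simp
      finally show ?thesis ..
    next
      case False
      then have "intertwiner n (?b j) g = 0" by (simp only: intertwiner_def if_False)
      moreover have "?b i g = 0" for i using False by (simp add: cell_indicator_def)
      ultimately show ?thesis by simp
    qed
  qed
  then show ?thesis by (simp add: has_matrix_def M_matrix_def)
qed

theorem theorem1p0p7:
  fixes n q :: nat
  assumes "q = card (UNIV :: 'a::{field, finite} set)"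
    and "\<not> 2 dvd q" and "\<not> 3 dvd q"
    and "n \<ge> 1"
  shows "(\<exists>b :: nat \<Rightarrow> 'a mat \<Rightarrow> complex.
            ordered_basis (n + 1) b (Ind_inv n) \<and>
            has_matrix (intertwiner n) (n + 1) b (M_matrix n (of_nat q))) \<and>
         diagonalizable (M_matrix n (of_nat q)) \<and>
         spectrum (M_matrix n (of_nat q)) =
           {(-1) ^ (n - i) * of_nat q ^ ((n choose 2) + ((i + 1) choose 2)) | i. i \<le> n}"
proof (intro conjI exI)
  have "q \<ge> 2" unfolding assms(1) by (rule card_UNIV_field_ge_2)
  note M = M_matrix_diagonalizable_spectrum[OF this]
  show "ordered_basis (n + 1) (cell_indicator n :: nat \<Rightarrow> 'a mat \<Rightarrow> complex) (Ind_inv n)"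
    using assms(4) by (rule ordered_basis_cell_indicator)
  show "has_matrix (intertwiner n) (n + 1) (cell_indicator n :: nat \<Rightarrow> 'a mat \<Rightarrow> complex) (M_matrix n (of_nat q))"
    unfolding assms(1) by (rule has_matrix_cell_indicator)
  show "diagonalizable (M_matrix n (of_nat q))" by (rule M(1))
  show "spectrum (M_matrix n (of_nat q)) =
      {(-1) ^ (n - i) * of_nat q ^ ((n choose 2) + ((i + 1) choose 2)) | i. i \<le> n}"
    unfolding M(2) M_eigenvalue_def ..
qed

end
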